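(* (Po2-Synchronization.) Let $\epsilon\in(0,\frac1{10})$, $\mathcal{V}>0$, $\ell$ a positive integer, and let $\tilde{\mathcal{V}}$ be a finite set of commodities with $|\tilde{\mathcal{V}}|\ge\frac{100\ln(1/\epsilon)}{\epsilon^4}$, each $i\in\tilde{\mathcal{V}}$ equipped with a SOSI interval $\hat T_i>0$ satisfying $\gamma_i\hat T_i/2\le\frac{\mathcal{V}}{(1+\epsilon)^{\ell-1}}$. Let $\mathcal{H}=\{i\in\tilde{\mathcal{V}}:\gamma_i\hat T_i/2>\frac34\cdot\frac{\mathcal{V}}{(1+\epsilon)^{\ell-1}}\}$ (heavy commodities). If $|\mathcal{H}|>|\tilde{\mathcal{V}}|/2$, then one can construct in polynomial time a random replenishment policy $\tilde{\mathcal{P}}=\{\tilde{\mathcal{P}}_i\}_{i\in\tilde{\mathcal{V}}}$ such that, almost surely, \[ V_{\max}(\tilde{\mathcal{P}})\le(1+6\epsilon)\cdot\frac{7/4}{\sqrt2\ln2}\cdot|\tilde{\mathcal{V}}|\cdot\frac{\mathcal{V}}{(1+\epsilon)^{\ell-1}}, \] and \[ \mathbb{E}[C(\tilde{\mathcal{P}})]\le\left(1+\frac{2\epsilon}{5}\right)\cdot\frac{32/31}{\sqrt2\ln2}\cdot\sum_{i\in\tilde{\mathcal{V}}}\left(\frac{K_i}{\hat T_i}+H_i\hat T_i\right). \]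
   Context: Each commodity $i$ has demand rate $1$ (met in full), ordering cost $K_i>0$ per order, holding cost rate $2H_i>0$ per unit per time, space requirement $\gamma_i>0$ per unit. A (dynamic) single-commodity policy is a sequence of ordering times $0=\tau_0<\tau_1<\cdots\to\infty$ with quantities $q_k$, inventory $I(t)=\sum_{k:\tau_k\le t}q_k-t\ge0$, and long-run average cost $\limsup_{t\to\infty}\frac1t(K_i\cdot\#\{k:\tau_k<t\}+2H_i\int_0^tI(s)ds)$. A SOSI policy with interval $T$ orders $T$ units at times $0,T,2T,\ldots$ and has cost $K_i/T+H_iT$. For a joint policy $\mathcal{P}$, $V_{\max}(\mathcal{P})=\sup_{t\ge0}\sum_i\gamma_iI_i(t)$ and $C(\mathcal{P})$ is the sum of the commodities' long-run average costs. *)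

theory Defs
  imports "HOL-Probability.Probability"
begin

section \<open>Replenishment policies\<close>

text \<open>Order number \<open>k\<close> of a dynamic single-commodity policy is placed at time
  \<open>order_time P k\<close> and has size \<open>order_qty P k\<close>.\<close>

record policy =
  order_time :: "nat \<Rightarrow> real"
  order_qty :: "nat \<Rightarrow> real"

definition inventory :: "policy \<Rightarrow> real \<Rightarrow> real" where
  "inventory P t = (\<Sum>k\<in>{k. order_time P k \<le> t}. order_qty P k) - t"

definition valid_policy :: "policy \<Rightarrow> bool" where
  "valid_policy P \<longleftrightarrow>
     order_time P 0 = 0 \<and> strict_mono (order_time P) \<and>
     filterlim (order_time P) at_top sequentially \<and>
     (\<forall>k. 0 \<le> order_qty P k) \<and> (\<forall>t\<ge>0. 0 \<le> inventory P t)"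

text \<open>The holding cost rate is twice the parameter \<open>h\<close>, so that ordering \<open>T\<close> units every
  \<open>T\<close> time units costs \<open>K / T + h * T\<close>.\<close>

definition long_run_cost :: "real \<Rightarrow> real \<Rightarrow> policy \<Rightarrow> ereal" where
  "long_run_cost K h P =
     Limsup at_top (\<lambda>t::real.
       ereal ((K * real (card {k. order_time P k < t})
               + 2 * h * integral {0..t} (inventory P)) / t))"


section \<open>Problem data\<close>

text \<open>The commodities are numbered \<open>0, \<dots>, num I - 1\<close>.\<close>

record problem =
  num :: nat
  eps :: real
  cap :: real
  lev :: nat
  K\<^sub>c :: "nat \<Rightarrow> real"
  H\<^sub>c :: "nat \<Rightarrow> real"
  gam :: "nat \<Rightarrow> real"
  That :: "nat \<Rightarrow> real"

definition level_cap :: "problem \<Rightarrow> real" where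
  "level_cap I = cap I / (1 + eps I) ^ (lev I - 1)"

definition heavy :: "problem \<Rightarrow> nat set" where
  "heavy I = {i. i < num I \<and> gam I i * That I i / 2 > 3 / 4 * level_cap I}"

definition V_max :: "problem \<Rightarrow> (nat \<Rightarrow> policy) \<Rightarrow> ereal" where
  "V_max I P = (SUP t\<in>{0..}. ereal (\<Sum>i<num I. gam I i * inventory (P i) t))"

definition joint_cost :: "problem \<Rightarrow> (nat \<Rightarrow> policy) \<Rightarrow> ereal" where
  "joint_cost I P = (\<Sum>i<num I. long_run_cost (K\<^sub>c I i) (H\<^sub>c I i) (P i))"


section \<open>Randomized real RAM\<close>

text \<open>The random source is an infinite sequence of independent uniform samples from
  the unit interval.\<close>

definition seeds :: "(nat \<Rightarrow> real) measure" where
  "seeds = PiM UNIV (\<lambda>_. restrict_space lborel {0..1})"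

lemma prob_space_seeds: "prob_space seeds"
  unfolding seeds_def
  by (intro prob_space_PiM prob_spaceI) (simp add: emeasure_restrict_space space_restrict_space)

lemma space_seeds: "space seeds = {\<omega>. \<forall>j. \<omega> j \<in> {0..1}}"
  by (auto simp: seeds_def space_PiM space_restrict_space PiE_def Pi_def)

text \<open>Structured programs with exact real arithmetic. Registers are addressed directly, heap
  cells through a register that holds a natural number. There is deliberately no rounding
  operation, which at unit cost would make the model unreasonably powerful; \<open>exp\<close> and \<open>ln\<close> are
  available because random powers \<open>2 powr \<theta>\<close> of a uniform real \<open>\<theta>\<close> need them.\<close>

datatype instr =
    Const nat rat
  | Add nat nat nat
  | Sub nat nat nat
  | Mul nat nat nat
  | Divide nat nat nat
  | Exp nat nat
  | Ln nat nat
  | Load nat nat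
  | Store nat nat
  | Draw nat

datatype prog =
    Instr instr
  | Seq prog prog
  | IfLess nat nat prog prog
  | WhileLess nat nat prog

record state =
  regs :: "nat \<Rightarrow> real"
  heap :: "nat \<Rightarrow> real"
  drawn :: nat

definition set_reg :: "nat \<Rightarrow> real \<Rightarrow> state \<Rightarrow> state" where
  "set_reg r x s = s\<lparr>regs := (regs s)(r := x)\<rparr>"

text \<open>\<open>None\<close> means that the operation is undefined, in which case the program does not halt
  regularly.\<close>

fun step :: "(nat \<Rightarrow> real) \<Rightarrow> instr \<Rightarrow> state \<Rightarrow> state option" where
  "step \<omega> (Const r c) s = Some (set_reg r (of_rat c) s)"
| "step \<omega> (Add r a b) s = Some (set_reg r (regs s a + regs s b) s)"
| "step \<omega> (Sub r a b) s = Some (set_reg r (regs s a - regs s b) s)"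
| "step \<omega> (Mul r a b) s = Some (set_reg r (regs s a * regs s b) s)"
| "step \<omega> (Divide r a b) s =
     (if regs s b = 0 then None else Some (set_reg r (regs s a / regs s b) s))"
| "step \<omega> (Exp r a) s = Some (set_reg r (exp (regs s a)) s)"
| "step \<omega> (Ln r a) s = (if regs s a > 0 then Some (set_reg r (ln (regs s a)) s) else None)"
| "step \<omega> (Load r a) s =
     (if regs s a \<in> \<nat> then Some (set_reg r (heap s (nat \<lfloor>regs s a\<rfloor>)) s) else None)"
| "step \<omega> (Store a r) s =
     (if regs s a \<in> \<nat> then Some (s\<lparr>heap := (heap s)(nat \<lfloor>regs s a\<rfloor> := regs s r)\<rparr>) else None)"
| "step \<omega> (Draw r) s = Some ((set_reg r (\<omega> (drawn s)) s)\<lparr>drawn := Suc (drawn s)\<rparr>)"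

text \<open>\<open>exec \<omega> p s n s'\<close>: on random tape \<open>\<omega>\<close>, program \<open>p\<close> started in \<open>s\<close> halts in \<open>s'\<close> after
  \<open>n\<close> unit-cost steps (instructions and evaluated tests).\<close>

inductive exec :: "(nat \<Rightarrow> real) \<Rightarrow> prog \<Rightarrow> state \<Rightarrow> nat \<Rightarrow> state \<Rightarrow> bool"
  for \<omega> :: "nat \<Rightarrow> real" where
  Instr: "step \<omega> c s = Some s' \<Longrightarrow> exec \<omega> (Instr c) s 1 s'"
| Seq: "exec \<omega> p s m s' \<Longrightarrow> exec \<omega> q s' n s'' \<Longrightarrow> exec \<omega> (Seq p q) s (m + n) s''"
| IfTrue: "regs s a < regs s b \<Longrightarrow> exec \<omega> p s n s' \<Longrightarrow> exec \<omega> (IfLess a b p q) s (Suc n) s'"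
| IfFalse: "\<not> regs s a < regs s b \<Longrightarrow> exec \<omega> q s n s' \<Longrightarrow> exec \<omega> (IfLess a b p q) s (Suc n) s'"
| WhileFalse: "\<not> regs s a < regs s b \<Longrightarrow> exec \<omega> (WhileLess a b p) s 1 s"
| WhileTrue: "regs s a < regs s b \<Longrightarrow> exec \<omega> p s m s' \<Longrightarrow> exec \<omega> (WhileLess a b p) s' n s'' \<Longrightarrow>
     exec \<omega> (WhileLess a b p) s (Suc (m + n)) s''"

inductive_cases InstrE: "exec \<omega> (Instr c) s n s'"
inductive_cases SeqE: "exec \<omega> (Seq p q) s n s'"
inductive_cases IfE: "exec \<omega> (IfLess a b p q) s n s'"
inductive_cases WhileE: "exec \<omega> (WhileLess a b p) s n s'"

lemma exec_deterministic:
  "exec \<omega> p s m s' \<Longrightarrow> exec \<omega> p s n s'' \<Longrightarrow> n = m \<and> s'' = s'"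
proof (induction arbitrary: n s'' rule: exec.induct)
  case (Instr c s s')
  from Instr.prems show ?case by (rule InstrE) (use Instr.hyps in simp)
next
  case (Seq p s m s1 q k s2)
  from Seq.prems obtain m' s1' k' where "n = m' + k'" "exec \<omega> p s m' s1'" "exec \<omega> q s1' k' s''"
    by (rule SeqE)
  with Seq.IH(1)[of m' s1'] Seq.IH(2)[of k' s''] show ?case by simp
next
  case (IfTrue s a b p k s1 q)
  from IfTrue.prems obtain k' where "n = Suc k'" "exec \<omega> p s k' s''"
    by (rule IfE) (use IfTrue.hyps(1) in simp_all)
  with IfTrue.IH[of k' s''] show ?case by simp
next
  case (IfFalse s a b q k s1 p)
  from IfFalse.prems obtain k' where "n = Suc k'" "exec \<omega> q s k' s''"
    by (rule IfE) (use IfFalse.hyps(1) in simp_all)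
  with IfFalse.IH[of k' s''] show ?case by simp
next
  case (WhileFalse s a b p)
  from WhileFalse.prems show ?case by (rule WhileE) (use WhileFalse.hyps in simp_all)
next
  case (WhileTrue s a b p m s1 k s2)
  from WhileTrue.prems obtain m' s1' k' where
    "n = Suc (m' + k')" "exec \<omega> p s m' s1'" "exec \<omega> (WhileLess a b p) s1' k' s''"
    by (rule WhileE) (use WhileTrue.hyps(1) in simp_all)
  with WhileTrue.IH(1)[of m' s1'] WhileTrue.IH(2)[of k' s''] show ?case by simp
qed


section \<open>Polynomial-time construction of a policy\<close>

text \<open>A random policy is given by a program that is asked for order number \<open>k\<close> of commodity
  \<open>i\<close> and answers with its time and quantity. Different queries are consistent because they read
  the same random tape from its beginning. An explicit list of orders would not do as output:
  even one period of a joint policy can contain exponentially many orders.\<close>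

definition query_state :: "problem \<Rightarrow> nat \<Rightarrow> nat \<Rightarrow> state" where
  "query_state I i k =
     \<lparr>regs = (\<lambda>r. let xs = [real (num I), eps I, cap I, real (lev I), real i, real k]
                  in if r < length xs then xs ! r else 0),
      heap = (\<lambda>a. let j = a div 4
                  in if j < num I then [K\<^sub>c I j, H\<^sub>c I j, gam I j, That I j] ! (a mod 4) else 0),
      drawn = 0\<rparr>"

text \<open>The size of a query: number of commodities plus magnitudes of all numbers involved. For
  rational data it is at most a constant times the binary encoding length.\<close>

definition query_size :: "problem \<Rightarrow> nat \<Rightarrow> real" where
  "query_size I k =
     real (num I) + \<bar>log 2 (eps I)\<bar> + \<bar>log 2 (cap I)\<bar> + log 2 (real (lev I)) +
     (\<Sum>j<num I. \<bar>log 2 (K\<^sub>c I j)\<bar> + \<bar>log 2 (H\<^sub>c I j)\<bar> + \<bar>log 2 (gam I j)\<bar> + \<bar>log 2 (That I j)\<bar>) +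
     log 2 (real (k + 1))"

definition constructs_within ::
    "prog \<Rightarrow> real \<Rightarrow> nat \<Rightarrow> problem \<Rightarrow> ((nat \<Rightarrow> real) \<Rightarrow> nat \<Rightarrow> policy) \<Rightarrow> bool" where
  "constructs_within p c d I \<P> \<longleftrightarrow>
     (\<forall>\<omega>\<in>space seeds. \<forall>i<num I. \<forall>k. \<exists>n s.
        exec \<omega> p (query_state I i k) n s \<and>
        regs s 0 = order_time (\<P> \<omega> i) k \<and> regs s 1 = order_qty (\<P> \<omega> i) k \<and>
        real n \<le> c * (1 + query_size I k) ^ d)"

definition random_policy :: "problem \<Rightarrow> ((nat \<Rightarrow> real) \<Rightarrow> nat \<Rightarrow> policy) \<Rightarrow> bool" where
  "random_policy I \<P> \<longleftrightarrow>
     (\<forall>i<num I. \<forall>k. (\<lambda>\<omega>. order_time (\<P> \<omega> i) k) \<in> borel_measurable seeds \<and>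
                    (\<lambda>\<omega>. order_qty (\<P> \<omega> i) k) \<in> borel_measurable seeds) \<and>
     (\<lambda>\<omega>. joint_cost I (\<P> \<omega>)) \<in> borel_measurable seeds \<and>
     (AE \<omega> in seeds. \<forall>i<num I. valid_policy (\<P> \<omega> i))"

text \<open>Costs of valid policies are nonnegative, so the conversion to \<open>ennreal\<close> loses nothing.\<close>

definition expected_cost :: "problem \<Rightarrow> ((nat \<Rightarrow> real) \<Rightarrow> nat \<Rightarrow> policy) \<Rightarrow> ennreal" where
  "expected_cost I \<P> = (\<integral>\<^sup>+\<omega>. e2ennreal (joint_cost I (\<P> \<omega>)) \<partial>seeds)"

end

theory Submission
  imports Defs
begin

text \<open>
  A deterministic policy suffices. Write \<open>M\<close> for \<open>level_cap I\<close>. Commodities are paired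
  greedily, two of them being compatible if their intervals differ by a factor below \<open>21 / 20\<close> or
  above \<open>28\<close>. The unpaired ones are pairwise incompatible, so there are at most \<open>101\<close> of them, a
  negligible number. Two nearly equal intervals are made equal and shifted by half an interval,
  which limits the joint peak to \<open>3 / 2 \<cdot> 2 M\<close>. If the intervals are far apart, the commodity
  with the small interval \<open>T\<close> uses orders of size \<open>7 / 9 \<cdot> T\<close> while the inventory of the other one
  is in its upper half, and of size \<open>5 / 4 \<cdot> T\<close> while it is in its lower half, which limits the
  joint peak to \<open>16 / 9 \<cdot> 2 M\<close>. All ordering and holding costs grow by a factor of at most
  \<open>21 / 20\<close>. Both constants are below those of the theorem.
\<close>

section \<open>Zero-inventory policies\<close>

text \<open>Uncoordinated, a commodity can contribute up to \<open>2 * level_cap I\<close> to the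
  peak. The theorem leaves, even for tiny \<open>eps I\<close>, about 1.785 times
  \<open>level_cap I\<close> per commodity and a cost factor of about 1.053. So a pair must save
  somewhat more than a tenth of its peak for at most five percent of cost. With sizes
  \<open>u * T\<close> and \<open>v * T\<close> for the small commodity, the relative joint peak is
  \<open>1 + u\<close> early in the large period and \<open>v + 1/2\<close> plus a straddling term
  later; the cost factors are \<open>(1/u + 1/v) / 2\<close> and \<open>(u + v) / 2\<close>. The
  choice \<open>u = 7/9\<close>, \<open>v = 5/4\<close> balances the peaks at
  \<open>16/9 = 1 + 7/9 = 5/4 + 1/2 + 1/36\<close>, with cost factors 73/70 and 73/72. Ratios
  between 21/20 and 28 are never treated as pairs; the bound on the leftovers does not depend on the
  number of commodities. The obstacle on the computational side is that the machine cannot round, so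
  the numbers of orders per half period cannot be made integral. Schedules are therefore evaluated
  at real order indices, and orders may straddle a change of size.\<close>

definition zero_inventory :: "(nat \<Rightarrow> real) \<Rightarrow> policy" where
  "zero_inventory \<tau> = \<lparr>order_time = \<tau>, order_qty = (\<lambda>k. \<tau> (Suc k) - \<tau> k)\<rparr>"

context
  fixes \<tau> :: "nat \<Rightarrow> real"
  assumes tau_0: "\<tau> 0 = 0" and tau_mono: "strict_mono \<tau>"
    and tau_lim: "filterlim \<tau> at_top sequentially"
begin

lemma order_interval:
  assumes "0 \<le> t"
  obtains k where "\<tau> k \<le> t" "t < \<tau> (Suc k)"
proof -
  have "eventually (\<lambda>n. t < \<tau> n) sequentially"
    using tau_lim by (simp add: filterlim_at_top_dense)
  then obtain n where n: "t < \<tau> n"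
    by (auto simp: eventually_sequentially)
  define m where "m = (LEAST n. t < \<tau> n)"
  have m: "t < \<tau> m" unfolding m_def using n by (rule LeastI)
  then have "m \<noteq> 0" using assms tau_0 by (auto intro: gr0I)
  then obtain k where k: "m = Suc k" by (cases m) auto
  have "\<not> t < \<tau> k" using not_less_Least[of k "\<lambda>n. t < \<tau> n"] k by (simp add: m_def)
  with m k that show thesis by force
qed

lemma inventory_zero_inventory:
  assumes "\<tau> k \<le> t" "t < \<tau> (Suc k)"
  shows "inventory (zero_inventory \<tau>) t = \<tau> (Suc k) - t"
proof -
  have "{j. \<tau> j \<le> t} = {..<Suc k}"
  proof (intro set_eqI iffI)
    fix j assume "j \<in> {j. \<tau> j \<le> t}"
    with assms have "\<tau> j < \<tau> (Suc k)" by simp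
    then show "j \<in> {..<Suc k}" by (simp add: strict_mono_less[OF tau_mono])
  next
    fix j assume "j \<in> {..<Suc k}"
    then have "\<tau> j \<le> \<tau> k" by (simp add: strict_mono_less_eq[OF tau_mono])
    with assms show "j \<in> {j. \<tau> j \<le> t}" by simp
  qed
  moreover have "(\<Sum>j<Suc k. \<tau> (Suc j) - \<tau> j) = \<tau> (Suc k)"
    by (subst sum_lessThan_telescope) (simp add: tau_0)
  ultimately show ?thesis by (simp add: inventory_def zero_inventory_def)
qed

lemma inventory_nonneg: "0 \<le> t \<Longrightarrow> 0 \<le> inventory (zero_inventory \<tau>) t"
  by (metis order_interval inventory_zero_inventory less_eq_real_def diff_ge_0_iff_ge)

lemma valid_zero_inventory: "valid_policy (zero_inventory \<tau>)"
  using tau_0 tau_mono tau_lim inventory_nonneg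
  by (auto simp: valid_policy_def zero_inventory_def strict_mono_less_eq)

text \<open>Between consecutive orders the inventory falls with slope -1 to zero, so each gap
  contributes a triangle of half its squared length.\<close>

lemma has_integral_inventory:
  "(inventory (zero_inventory \<tau>) has_integral (\<Sum>k<n. (\<tau> (Suc k) - \<tau> k)\<^sup>2) / 2) {0..\<tau> n}"
proof (induction n)
  case 0
  then show ?case using has_integral_refl(1)[of "inventory (zero_inventory \<tau>)" "0::real"] by (simp add: tau_0)
next
  case (Suc n)
  have le: "\<tau> n \<le> \<tau> (Suc n)" "0 \<le> \<tau> n"
    using strict_mono_less_eq[OF tau_mono] tau_0 by (simp, metis le0)
  have "((\<lambda>t. \<tau> (Suc n) - t) has_integral
      - ((\<tau> (Suc n) - \<tau> (Suc n))\<^sup>2 / 2) - - ((\<tau> (Suc n) - \<tau> n)\<^sup>2 / 2)) {\<tau> n..\<tau> (Suc n)}"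
    by (rule fundamental_theorem_of_calculus[OF le(1)])
       (auto intro!: derivative_eq_intros simp: field_simps simp flip: has_real_derivative_iff_has_vector_derivative)
  then have "((\<lambda>t. \<tau> (Suc n) - t) has_integral (\<tau> (Suc n) - \<tau> n)\<^sup>2 / 2) {\<tau> n..\<tau> (Suc n)}"
    by simp
  \<comment> \<open>At the right endpoint the next order has already arrived; a single point does
    not change the integral.\<close>
  then have "(inventory (zero_inventory \<tau>) has_integral (\<tau> (Suc n) - \<tau> n)\<^sup>2 / 2) {\<tau> n..\<tau> (Suc n)}"
    by (rule has_integral_spike_finite[rotated 2, where S = "{\<tau> (Suc n)}"])
       (auto intro!: inventory_zero_inventory)
  from has_integral_combine[OF le(2,1) Suc.IH this] show ?case
    by (simp add: add_divide_distrib)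
qed

text \<open>Two linear estimates control the limsup: one on the order index and one on the sum of
  squared gaps. The additive errors \<open>c\<^sub>1\<close> and \<open>c\<^sub>2\<close> vanish
  after division by \<open>t\<close>, which leaves room for incomplete periods and shifted
  starts.\<close>

lemma long_run_cost_zero_inventory_le:
  fixes c\<^sub>1 c\<^sub>2 \<kappa> \<eta> v :: real
  assumes nonneg: "0 \<le> K" "0 \<le> h"
    and count: "\<And>k. real k * c \<le> \<tau> k + c\<^sub>1" "c > 0" "1 / c \<le> \<kappa>" "0 \<le> c\<^sub>1"
    and squares: "\<And>n. (\<Sum>k<n. (\<tau> (Suc k) - \<tau> k)\<^sup>2) \<le> \<eta> * \<tau> n + c\<^sub>2" "0 \<le> \<eta>"
    and step: "\<And>k. \<tau> (Suc k) - \<tau> k \<le> v"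
  shows "long_run_cost K h (zero_inventory \<tau>) \<le> ereal (K * \<kappa> + h * \<eta>)"
proof -
  define B where "B = K * (c\<^sub>1 * \<kappa> + 2) + h * (\<eta> * v + c\<^sub>2)"
  have bound: "(K * real (card {k. order_time (zero_inventory \<tau>) k < t})
       + 2 * h * integral {0..t} (inventory (zero_inventory \<tau>))) / t \<le> (K * \<kappa> + h * \<eta>) + B / t"
    if t: "t > 0" for t
  proof -
    have "{k. \<tau> k < t} \<subseteq> {..nat \<lfloor>(t + c\<^sub>1) / c\<rfloor>}"
    proof
      fix k assume "k \<in> {k. \<tau> k < t}"
      then have "real k * c \<le> t + c\<^sub>1" using count(1)[of k] by simp
      then have "real k \<le> (t + c\<^sub>1) / c" using count(2) by (simp add: field_simps)
      then show "k \<in> {..nat \<lfloor>(t + c\<^sub>1) / c\<rfloor>}" by (simp add: le_nat_floor)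
    qed
    then have "card {k. \<tau> k < t} \<le> Suc (nat \<lfloor>(t + c\<^sub>1) / c\<rfloor>)"
      using card_mono[of "{..nat \<lfloor>(t + c\<^sub>1) / c\<rfloor>}"] by simp
    then have "real (card {k. \<tau> k < t}) \<le> 1 + real (nat \<lfloor>(t + c\<^sub>1) / c\<rfloor>)" by linarith
    also have "\<dots> \<le> 1 + (t + c\<^sub>1) * (1 / c)"
      using t count by (simp add: of_nat_nat)
    also have "\<dots> \<le> 1 + (t + c\<^sub>1) * \<kappa>"
      using t count by (intro add_left_mono mult_left_mono) auto
    finally have card: "real (card {k. \<tau> k < t}) \<le> t * \<kappa> + (c\<^sub>1 * \<kappa> + 2)" by (simp add: algebra_simps)
    obtain n where n: "\<tau> n \<le> t" "t < \<tau> (Suc n)" using order_interval[of t] t by auto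
    note int = has_integral_inventory[of "Suc n"]
    \<comment> \<open>The inventory is nonnegative, so the integral may be extended to the end of
      the current gap, which lengthens the time by at most \<open>v\<close>.\<close>
    have "integral {0..t} (inventory (zero_inventory \<tau>))
        \<le> integral {0..\<tau> (Suc n)} (inventory (zero_inventory \<tau>))"
      using n t int inventory_nonneg
      by (intro integral_subset_le integrable_on_subinterval[OF has_integral_integrable[OF int]]) auto
    also have "\<dots> = (\<Sum>k<Suc n. (\<tau> (Suc k) - \<tau> k)\<^sup>2) / 2"
      using int by (rule integral_unique)
    also have "\<dots> \<le> (\<eta> * \<tau> (Suc n) + c\<^sub>2) / 2"
      using squares(1)[of "Suc n"] by simp
    also have "\<eta> * \<tau> (Suc n) \<le> \<eta> * (t + v)"
      using squares(2) step[of n] n by (intro mult_left_mono) auto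
    finally have "2 * integral {0..t} (inventory (zero_inventory \<tau>)) \<le> t * \<eta> + (\<eta> * v + c\<^sub>2)"
      by (simp add: algebra_simps)
    then have "h * (2 * integral {0..t} (inventory (zero_inventory \<tau>))) \<le> h * (t * \<eta> + (\<eta> * v + c\<^sub>2))"
      using nonneg by (intro mult_left_mono) auto
    moreover have "K * real (card {k. \<tau> k < t}) \<le> K * (t * \<kappa> + (c\<^sub>1 * \<kappa> + 2))"
      using card nonneg by (intro mult_left_mono) auto
    ultimately have "K * real (card {k. order_time (zero_inventory \<tau>) k < t})
       + 2 * h * integral {0..t} (inventory (zero_inventory \<tau>)) \<le> t * (K * \<kappa> + h * \<eta>) + B"
      by (simp add: zero_inventory_def B_def algebra_simps)
    then have "(K * real (card {k. order_time (zero_inventory \<tau>) k < t})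
       + 2 * h * integral {0..t} (inventory (zero_inventory \<tau>))) / t \<le> (t * (K * \<kappa> + h * \<eta>) + B) / t"
      using t by (intro divide_right_mono) auto
    then show ?thesis using t by (simp add: add_divide_distrib)
  qed
  have "((\<lambda>t::real. (K * \<kappa> + h * \<eta>) + B / t) \<longlongrightarrow> (K * \<kappa> + h * \<eta>) + 0) at_top"
    by (intro tendsto_add tendsto_const tendsto_divide_0[OF tendsto_const] filterlim_ident
        filterlim_at_top_imp_at_infinity)
  then have lim: "((\<lambda>t::real. ereal ((K * \<kappa> + h * \<eta>) + B / t)) \<longlongrightarrow> ereal (K * \<kappa> + h * \<eta>)) at_top"
    by simp
  have "long_run_cost K h (zero_inventory \<tau>)
      \<le> Limsup at_top (\<lambda>t::real. ereal ((K * \<kappa> + h * \<eta>) + B / t))"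
    unfolding long_run_cost_def
    by (intro Limsup_mono eventually_mono[OF eventually_gt_at_top[of 0]]) (use bound in auto)
  also have "\<dots> = ereal (K * \<kappa> + h * \<eta>)"
    by (rule lim_imp_Limsup[OF _ lim]) simp
  finally show ?thesis .
qed

end


section \<open>Two-rate schedules\<close>

definition small_count :: "real \<Rightarrow> real \<Rightarrow> real" where
  "small_count D u = D / (2 * u)"

definition period_count :: "real \<Rightarrow> real \<Rightarrow> real \<Rightarrow> real" where
  "period_count D u v = D / (2 * u) + D / (2 * v)"

text \<open>As a function of the order index this is the primitive of the indicator of the
  small-order phase. Hence \<open>order_position\<close> has slope \<open>u\<close> in that phase
  and slope \<open>v\<close> outside it.\<close>

definition small_orders :: "real \<Rightarrow> real \<Rightarrow> real \<Rightarrow> real \<Rightarrow> real" where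
  "small_orders D u v x =
     (let N = period_count D u v; m = real_of_int \<lfloor>x / N\<rfloor>
      in m * small_count D u + min (x - m * N) (small_count D u))"

text \<open>In every period of length \<open>D\<close> the orders have size \<open>u\<close> during the first half and \<open>v\<close>
  during the second half. The order index \<open>x\<close> is treated as a real number, so that a period may
  contain a fractional number of orders and nothing has to be rounded.\<close>

definition order_position :: "real \<Rightarrow> real \<Rightarrow> real \<Rightarrow> real \<Rightarrow> real" where
  "order_position D u v x = v * x - (v - u) * small_orders D u v x"

text \<open>The maximum keeps order 0 at time 0. For \<open>0 < s < 1\<close> the first gap covers
  only \<open>1 - s\<close> of an index unit and all later orders come correspondingly
  early.\<close>

definition schedule :: "real \<Rightarrow> real \<Rightarrow> real \<Rightarrow> real \<Rightarrow> nat \<Rightarrow> real" where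
  "schedule D u v s k = order_position D u v (max 0 (real k - s))"

lemma order_position_same: "order_position D u u x = u * x"
  by (simp add: order_position_def)

context
  fixes D u v :: real
  assumes D: "0 < D" and u: "0 < u" and uv: "u \<le> v"
begin

abbreviation (input) "N\<^sub>1 \<equiv> small_count D u"
abbreviation (input) "N \<equiv> period_count D u v"

lemma N_pos: "0 < N\<^sub>1" "N\<^sub>1 < N" "0 < N"
  using D u uv by (auto simp: small_count_def period_count_def intro: add_pos_pos)

text \<open>The range of \<open>r\<close> is closed so that a period boundary may be written in both
  ways; the program can end with a remainder equal to the full period.\<close>

lemma small_orders_eq:
  assumes "0 \<le> r" "r \<le> N"
  shows "small_orders D u v (real_of_int m * N + r) = real_of_int m * N\<^sub>1 + min r N\<^sub>1"
proof (cases "r = N")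
  case True
  then have eq: "real_of_int m * N + r = real_of_int (m + 1) * N"
    by (simp only: of_int_add of_int_1 distrib_right mult_1_left)
  have fl: "\<lfloor>(real_of_int m * N + r) / N\<rfloor> = m + 1"
    unfolding eq using N_pos(3) by simp
  show ?thesis
    unfolding small_orders_def Let_def fl unfolding eq using N_pos True
    by (simp add: algebra_simps)
next
  case False
  then have "r / N < 1" "0 \<le> r / N"
    using assms N_pos(3) by (auto simp del: add_divide_distrib)
  moreover have "(real_of_int m * N + r) / N = real_of_int m + r / N"
    using N_pos(3) by (simp add: add_divide_distrib)
  ultimately have fl: "\<lfloor>(real_of_int m * N + r) / N\<rfloor> = m"
    by (simp add: floor_eq_iff)
  show ?thesis unfolding small_orders_def Let_def fl by (simp add: algebra_simps)
qed

lemma period_decomposition: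
  obtains m r where "x = real_of_int m * N + r" "0 \<le> r" "r < N"
proof
  show "x = real_of_int \<lfloor>x / N\<rfloor> * N + (x - real_of_int \<lfloor>x / N\<rfloor> * N)" by simp
  show "0 \<le> x - real_of_int \<lfloor>x / N\<rfloor> * N"
    using floor_divide_lower[OF N_pos(3), of x] by simp
  show "x - real_of_int \<lfloor>x / N\<rfloor> * N < N"
    using floor_divide_upper[OF N_pos(3), of x] by (simp add: algebra_simps)
qed

lemma small_orders_0: "small_orders D u v 0 = 0"
  using small_orders_eq[of 0 0] N_pos by simp

text \<open>A primitive of an indicator function has slopes between 0 and 1.\<close>

lemma small_orders_mono_lipschitz:
  assumes "x \<le> y"
  shows "small_orders D u v x \<le> small_orders D u v y"
    and "small_orders D u v y - small_orders D u v x \<le> y - x"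
proof -
  obtain m r where x: "x = real_of_int m * N + r" "0 \<le> r" "r < N" by (rule period_decomposition)
  obtain m' r' where y: "y = real_of_int m' * N + r'" "0 \<le> r'" "r' < N" by (rule period_decomposition)
  have sx: "small_orders D u v x = real_of_int m * N\<^sub>1 + min r N\<^sub>1"
    using small_orders_eq[of r m] x by simp
  have sy: "small_orders D u v y = real_of_int m' * N\<^sub>1 + min r' N\<^sub>1"
    using small_orders_eq[of r' m'] y by simp
  have N2: "0 < N - N\<^sub>1" using N_pos by simp
  consider "m' < m" | "m = m'" | "m < m'" by linarith
  then have "small_orders D u v x \<le> small_orders D u v y \<and>
    small_orders D u v y - small_orders D u v x \<le> y - x"
  proof cases
    case 1
    then have "real_of_int m' + 1 \<le> real_of_int m" by linarith
    then have "(real_of_int m' + 1) * N \<le> real_of_int m * N"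
      using N_pos by (intro mult_right_mono) auto
    then have "y < x" using x y by (simp add: distrib_right)
    with assms show ?thesis by simp
  next
    case 2
    then have "r \<le> r'" using assms x y by simp
    then show ?thesis unfolding sx sy unfolding x(1) y(1) 2 by (auto simp: min_def)
  next
    case 3
    \<comment> \<open>Multiplying this by the phase lengths \<open>N\<^sub>1\<close> and
      \<open>N - N\<^sub>1\<close> counts the indices of the two phases separately; the first count
      gives monotonicity, the second the Lipschitz bound.\<close>
    then have 1: "real_of_int m + 1 \<le> real_of_int m'" by linarith
    have "(real_of_int m + 1) * N\<^sub>1 \<le> real_of_int m' * N\<^sub>1"
      using N_pos 1 by (intro mult_right_mono) auto
    moreover have "(real_of_int m + 1) * (N - N\<^sub>1) \<le> real_of_int m' * (N - N\<^sub>1)"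
      using N2 1 by (intro mult_right_mono) auto
    moreover have "0 \<le> min r' N\<^sub>1" "min r' N\<^sub>1 \<le> r'" "min r N\<^sub>1 \<le> N\<^sub>1" "r - min r N\<^sub>1 \<le> N - N\<^sub>1"
      using x y N_pos by (auto simp: min_def)
    ultimately show ?thesis
      unfolding sx sy unfolding x(1) y(1) distrib_right right_diff_distrib mult_1_left by linarith
  qed
  then show "small_orders D u v x \<le> small_orders D u v y"
    "small_orders D u v y - small_orders D u v x \<le> y - x" by auto
qed

text \<open>Within a period the small orders come first, so the count is concave there. It meets the
  line of slope \<open>N\<^sub>1 / N\<close> at both ends and exceeds it by at most
  \<open>N\<^sub>1\<close> in between.\<close>

lemma small_orders_linear:
  "x * (N\<^sub>1 / N) \<le> small_orders D u v x" "small_orders D u v x \<le> x * (N\<^sub>1 / N) + N\<^sub>1"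
proof -
  obtain m r where x: "x = real_of_int m * N + r" "0 \<le> r" "r < N" by (rule period_decomposition)
  have sx: "small_orders D u v x = real_of_int m * N\<^sub>1 + min r N\<^sub>1"
    using small_orders_eq[of r m] x by simp
  have eq: "x * (N\<^sub>1 / N) = real_of_int m * N\<^sub>1 + r * (N\<^sub>1 / N)"
    unfolding x(1) using N_pos(3) by (simp add: add_divide_distrib distrib_right)
  have "r * (N\<^sub>1 / N) \<le> r * 1"
    using x N_pos by (intro mult_left_mono) auto
  moreover have "r * (N\<^sub>1 / N) \<le> N * (N\<^sub>1 / N)"
    using x N_pos by (intro mult_right_mono) auto
  moreover have "N * (N\<^sub>1 / N) = N\<^sub>1" using N_pos by simp
  moreover have "0 \<le> r * (N\<^sub>1 / N)" using x N_pos by simp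
  ultimately show "x * (N\<^sub>1 / N) \<le> small_orders D u v x"
    "small_orders D u v x \<le> x * (N\<^sub>1 / N) + N\<^sub>1"
    unfolding sx eq by auto
qed

lemma order_position_0: "order_position D u v 0 = 0"
  by (simp add: order_position_def small_orders_0)

lemma order_position_diff:
  assumes "x \<le> y"
  shows "u * (y - x) \<le> order_position D u v y - order_position D u v x"
    and "order_position D u v y - order_position D u v x \<le> v * (y - x)"
proof -
  let ?a = "small_orders D u v y - small_orders D u v x"
  have eq: "order_position D u v y - order_position D u v x = v * (y - x) - (v - u) * ?a"
    by (simp add: order_position_def algebra_simps)
  have "(v - u) * ?a \<le> (v - u) * (y - x)"
    using small_orders_mono_lipschitz[OF assms] uv by (intro mult_left_mono) auto
  moreover have "0 \<le> (v - u) * ?a"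
    using small_orders_mono_lipschitz[OF assms] uv by simp
  ultimately show "u * (y - x) \<le> order_position D u v y - order_position D u v x"
    "order_position D u v y - order_position D u v x \<le> v * (y - x)"
    unfolding eq by (auto simp: algebra_simps)
qed

text \<open>By Jensen's inequality the squared order size is at most the increment of the function
  whose slope is \<open>u\<^sup>2\<close> and \<open>v\<^sup>2\<close> where the slope of the order position is \<open>u\<close> and \<open>v\<close>.\<close>

lemma order_position_diff_square:
  assumes "x \<le> y" "y \<le> x + 1"
  shows "(order_position D u v y - order_position D u v x)\<^sup>2 \<le>
    (v\<^sup>2 * y - (v\<^sup>2 - u\<^sup>2) * small_orders D u v y) - (v\<^sup>2 * x - (v\<^sup>2 - u\<^sup>2) * small_orders D u v x)"
proof -
  define a where "a = small_orders D u v y - small_orders D u v x"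
  define b where "b = (y - x) - a"
  have ab: "0 \<le> a" "0 \<le> b" "a + b \<le> 1"
    using small_orders_mono_lipschitz[OF assms(1)] assms by (auto simp: a_def b_def)
  have "order_position D u v y - order_position D u v x = u * a + v * b"
    by (simp add: order_position_def a_def b_def algebra_simps)
  moreover have "(u * a + v * b)\<^sup>2 \<le> (a + b) * (u\<^sup>2 * a + v\<^sup>2 * b)"
  proof -
    have "(a + b) * (u\<^sup>2 * a + v\<^sup>2 * b) - (u * a + v * b)\<^sup>2 = a * b * (u - v)\<^sup>2"
      by (simp add: power2_eq_square algebra_simps)
    also have "\<dots> \<ge> 0" using ab by simp
    finally show ?thesis by simp
  qed
  moreover have "(a + b) * (u\<^sup>2 * a + v\<^sup>2 * b) \<le> 1 * (u\<^sup>2 * a + v\<^sup>2 * b)"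
    using ab by (intro mult_right_mono) auto
  moreover have "u\<^sup>2 * a + v\<^sup>2 * b = (v\<^sup>2 * y - (v\<^sup>2 - u\<^sup>2) * small_orders D u v y)
      - (v\<^sup>2 * x - (v\<^sup>2 - u\<^sup>2) * small_orders D u v x)"
    by (simp add: a_def b_def algebra_simps)
  ultimately show ?thesis by simp
qed

lemma average_order: "D / N = v - (v - u) * (N\<^sub>1 / N)"
proof -
  have "v * N - (v - u) * N\<^sub>1 = D"
    using u uv by (simp add: small_count_def period_count_def field_simps)
  then show ?thesis using N_pos(3) by (simp add: field_simps)
qed

text \<open>Multiplied by \<open>N\<close>, both sides are the sum of squared order sizes over one
  period: half a period of orders of size \<open>w\<close> contributes
  \<open>w * D / 2\<close>.\<close>

lemma average_square: "(u + v) / 2 * (D / N) = v\<^sup>2 - (v\<^sup>2 - u\<^sup>2) * (N\<^sub>1 / N)"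
proof -
  have "v\<^sup>2 * N - (v\<^sup>2 - u\<^sup>2) * N\<^sub>1 = (u + v) / 2 * D"
    using u uv by (simp add: small_count_def period_count_def field_simps power2_eq_square)
  then have "(u + v) / 2 * (D / N) = (v\<^sup>2 * N - (v\<^sup>2 - u\<^sup>2) * N\<^sub>1) / N"
    by (metis times_divide_eq_right)
  then show ?thesis using N_pos(3) by (simp add: diff_divide_distrib)
qed

text \<open>Because small orders come first, the position lags behind the mean line of slope
  \<open>D / N\<close>, but by no more than the shortfall of one small phase.\<close>

lemma order_position_lower: "x * (D / N) \<le> order_position D u v x + (v - u) * N\<^sub>1"
proof -
  have "(v - u) * small_orders D u v x \<le> (v - u) * (x * (N\<^sub>1 / N) + N\<^sub>1)"
    using small_orders_linear uv by (intro mult_left_mono) auto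
  then show ?thesis
    unfolding average_order order_position_def by (simp add: algebra_simps)
qed

section \<open>Long-run cost and inventory of shifted schedules\<close>

context
  fixes s :: real
  assumes s: "0 \<le> s" "s < 1"
begin

lemma schedule_0: "schedule D u v s 0 = 0"
  using s order_position_0 by (simp add: schedule_def)

lemma schedule_step: "schedule D u v s (Suc k) - schedule D u v s k \<le> v"
proof -
  let ?x = "max 0 (real k - s)" and ?y = "max 0 (real (Suc k) - s)"
  have le: "?x \<le> ?y" "?y - ?x \<le> 1" using s by (auto simp: max_def)
  have "v * (?y - ?x) \<le> v * 1" using le u uv by (intro mult_left_mono) auto
  then show ?thesis using order_position_diff(2)[OF le(1)] by (simp add: schedule_def)
qed

lemma strict_mono_schedule: "strict_mono (schedule D u v s)"
proof (rule strict_mono_Suc_iff[THEN iffD2], rule allI)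
  fix k
  let ?x = "max 0 (real k - s)" and ?y = "max 0 (real (Suc k) - s)"
  have le: "?x < ?y" using s by (auto simp: max_def)
  then have "0 < u * (?y - ?x)" using u by simp
  then show "schedule D u v s k < schedule D u v s (Suc k)"
    using order_position_diff(1)[of ?x ?y] le unfolding schedule_def by linarith
qed

lemma filterlim_schedule: "filterlim (schedule D u v s) at_top sequentially"
proof (rule filterlim_at_top_mono)
  show "filterlim (\<lambda>k. u * (real k - 1)) at_top sequentially"
    using u by real_asymp
  show "eventually (\<lambda>k. u * (real k - 1) \<le> schedule D u v s k) sequentially"
  proof (rule always_eventually, rule allI)
    fix k
    have "u * (real k - 1) \<le> u * (max 0 (real k - s) - 0)"
      using s u by (intro mult_left_mono) auto
    also have "\<dots> \<le> schedule D u v s k"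
      using order_position_diff(1)[of 0 "max 0 (real k - s)"] order_position_0
      by (simp add: schedule_def)
    finally show "u * (real k - 1) \<le> schedule D u v s k" .
  qed
qed

text \<open>Each order size governs half of the time. Hence the order frequency is the mean of
  \<open>1 / u\<close> and \<open>1 / v\<close>, and twice the average inventory is the mean of
  \<open>u\<close> and \<open>v\<close>.\<close>

lemma long_run_cost_schedule_le:
  assumes "0 \<le> K" "0 \<le> h"
  shows "long_run_cost K h (zero_inventory (schedule D u v s)) \<le>
    ereal (K * ((1 / u + 1 / v) / 2) + h * ((u + v) / 2))"
proof (rule long_run_cost_zero_inventory_le[OF schedule_0 strict_mono_schedule filterlim_schedule assms,
        where c = "D / N" and c\<^sub>1 = "(v - u) * N\<^sub>1 + D / N"
          and c\<^sub>2 = "(u + v) / 2 * ((v - u) * N\<^sub>1)" and v = v])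
  let ?x = "\<lambda>k. max 0 (real k - s)"
  show "0 < D / N" using D N_pos by simp
  show "1 / (D / N) \<le> (1 / u + 1 / v) / 2"
    using D u uv by (simp add: period_count_def add_divide_distrib)
  show "0 \<le> (v - u) * N\<^sub>1 + D / N" using uv N_pos D by (intro add_nonneg_nonneg mult_nonneg_nonneg) auto
  show "0 \<le> (u + v) / 2" using u uv by simp
  show "schedule D u v s (Suc k) - schedule D u v s k \<le> v" for k by (rule schedule_step)
  show "real k * (D / N) \<le> schedule D u v s k + ((v - u) * N\<^sub>1 + D / N)" for k
  proof -
    \<comment> \<open>The shift loses less than one index; this is the summand \<open>D / N\<close>
      in the additive error.\<close>
    have "real k * (D / N) \<le> (?x k + 1) * (D / N)"
      using s D N_pos by (intro mult_right_mono) auto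
    then show ?thesis
      using order_position_lower[of "?x k"] unfolding schedule_def distrib_right by linarith
  qed
  show "(\<Sum>k<n. (schedule D u v s (Suc k) - schedule D u v s k)\<^sup>2)
      \<le> (u + v) / 2 * schedule D u v s n + (u + v) / 2 * ((v - u) * N\<^sub>1)" for n
  proof -
    let ?q = "\<lambda>x. v\<^sup>2 * x - (v\<^sup>2 - u\<^sup>2) * small_orders D u v x"
    have sq: "u\<^sup>2 \<le> v\<^sup>2" using u uv by (intro power_mono) auto
    have "(\<Sum>k<n. (schedule D u v s (Suc k) - schedule D u v s k)\<^sup>2)
        \<le> (\<Sum>k<n. ?q (?x (Suc k)) - ?q (?x k))"
      unfolding schedule_def using s by (intro sum_mono order_position_diff_square) auto
    also have "\<dots> = ?q (?x n)"
      using s by (subst sum_lessThan_telescope) (simp add: small_orders_0)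
    also have "\<dots> \<le> v\<^sup>2 * ?x n - (v\<^sup>2 - u\<^sup>2) * (?x n * (N\<^sub>1 / N))"
      using small_orders_linear(1)[of "?x n"] sq by (intro diff_left_mono mult_left_mono) auto
    also have "\<dots> = (v\<^sup>2 - (v\<^sup>2 - u\<^sup>2) * (N\<^sub>1 / N)) * ?x n"
    proof -
      have "v\<^sup>2 * x - (v\<^sup>2 - u\<^sup>2) * (x * c) = (v\<^sup>2 - (v\<^sup>2 - u\<^sup>2) * c) * x" for x c
        by (simp add: algebra_simps)
      then show ?thesis .
    qed
    also have "\<dots> = (u + v) / 2 * (?x n * (D / N))"
      unfolding average_square[symmetric] by (simp only: mult_ac)
    also have "\<dots> \<le> (u + v) / 2 * (schedule D u v s n + (v - u) * N\<^sub>1)"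
      using order_position_lower[of "?x n"] u uv
      by (intro mult_left_mono) (auto simp: schedule_def)
    finally show ?thesis by (simp add: distrib_left)
  qed
qed

lemmas valid_schedule = valid_zero_inventory[OF schedule_0 strict_mono_schedule filterlim_schedule]

lemma inventory_schedule_le:
  assumes "0 \<le> t"
  shows "inventory (zero_inventory (schedule D u v s)) t \<le> v"
proof -
  obtain k where k: "schedule D u v s k \<le> t" "t < schedule D u v s (Suc k)"
    by (rule order_interval[OF schedule_0 strict_mono_schedule filterlim_schedule assms])
  then show ?thesis
    using inventory_zero_inventory[OF schedule_0 strict_mono_schedule filterlim_schedule k]
      schedule_step[of k] by simp
qed

end

text \<open>Let \<open>x\<close> be the real index whose position is the given time. The last order
  placed has index \<open>k \<le> x\<close>, so the next one comes no later than position
  \<open>x + 1\<close>, which is still in the small phase. No alignment of orders with periods is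
  involved.\<close>

lemma inventory_schedule_first_half_le:
  assumes "0 \<le> \<rho>" "\<rho> + u \<le> D / 2"
  shows "inventory (zero_inventory (schedule D u v 0)) (real m * D + \<rho>) \<le> u"
proof -
  have s: "(0::real) \<le> 0" "(0::real) < 1" by auto
  note facts = schedule_0[OF s] strict_mono_schedule[OF s] filterlim_schedule[OF s]
  define x where "x = real m * N + \<rho> / u"
  have pos: "order_position D u v (real m * N + r) = real m * D + u * r"
    if "0 \<le> r" "r \<le> N\<^sub>1" for r
  proof -
    have "small_orders D u v (real_of_int (int m) * N + r) = real_of_int (int m) * N\<^sub>1 + min r N\<^sub>1"
      using that N_pos by (intro small_orders_eq) auto
    then have "order_position D u v (real m * N + r) = real m * (v * N - (v - u) * N\<^sub>1) + u * r"
      using that by (simp add: order_position_def algebra_simps min_def)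
    also have "v * N - (v - u) * N\<^sub>1 = D"
      using u uv by (simp add: small_count_def period_count_def field_simps)
    finally show ?thesis .
  qed
  have "\<rho> / u + 1 \<le> N\<^sub>1"
    using mult_right_mono[OF assms(2), of "1 / u"] u by (simp add: small_count_def add_divide_distrib)
  moreover have "0 \<le> \<rho> / u" using assms u by simp
  ultimately have x: "order_position D u v x = real m * D + \<rho>"
    and x1: "order_position D u v (x + 1) = real m * D + \<rho> + u"
    using pos[of "\<rho> / u"] pos[of "\<rho> / u + 1"] u unfolding x_def
    by (simp_all add: distrib_left add.assoc)
  obtain k where k: "schedule D u v 0 k \<le> real m * D + \<rho>" "real m * D + \<rho> < schedule D u v 0 (Suc k)"
    using assms D by (elim order_interval[OF facts, rotated]) auto
  have "real k \<le> x"
  proof (rule ccontr)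
    assume "\<not> real k \<le> x"
    then have "x \<le> real k" "0 < u * (real k - x)" using u by auto
    then show False using order_position_diff(1)[of x "real k"] k(1) x by (simp add: schedule_def)
  qed
  then have "order_position D u v (real (Suc k)) \<le> order_position D u v (x + 1)"
    using order_position_diff(1)[of "real (Suc k)" "x + 1"] u
    by (smt (verit) mult_nonneg_nonneg of_nat_Suc)
  then show ?thesis
    using inventory_zero_inventory[OF facts k] x1
    unfolding schedule_def[of D u v 0 "Suc k"] by simp
qed

end

section \<open>Peaks of coordinated pairs\<close>

lemma schedule_same: "schedule T T T s k = T * max 0 (real k - s)"
  by (simp add: schedule_def order_position_same)

lemma inventory_stationary:
  assumes "0 < T" "0 \<le> t"
  obtains m where "real m * T \<le> t" "t < real m * T + T"
    and "inventory (zero_inventory (schedule T T T 0)) t = real m * T + T - t"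
proof -
  have s: "(0::real) \<le> 0" "(0::real) < 1" by auto
  note facts = schedule_0[OF assms(1,1) order_refl s] strict_mono_schedule[OF assms(1,1) order_refl s]
    filterlim_schedule[OF assms(1,1) order_refl s]
  obtain m where m: "schedule T T T 0 m \<le> t" "t < schedule T T T 0 (Suc m)"
    by (rule order_interval[OF facts assms(2)])
  have sch: "schedule T T T 0 k = real k * T" for k by (simp add: schedule_same)
  show thesis
    using inventory_zero_inventory[OF facts m] m that[of m]
    unfolding sch by (simp add: distrib_right add.commute)
qed

text \<open>At offset \<open>r\<close> in the first commodity's interval, the inventories are
  \<open>T - r\<close> and \<open>T/2 - r\<close> before the half and \<open>T - r\<close> and
  \<open>3/2 * T - r\<close> from the half on. The sum is largest at \<open>r = 0\<close> and
  \<open>r = T/2\<close>.\<close>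

lemma near_pair_peak:
  assumes T: "0 < T" and t: "0 \<le> t"
  shows "inventory (zero_inventory (schedule T T T 0)) t
    + inventory (zero_inventory (schedule T T T (1/2))) t \<le> 3 / 2 * T"
proof -
  have s: "(0::real) \<le> 1/2" "(1/2::real) < 1" by auto
  note facts = schedule_0[OF T T order_refl s] strict_mono_schedule[OF T T order_refl s]
    filterlim_schedule[OF T T order_refl s]
  obtain m where m: "real m * T \<le> t" "t < real m * T + T"
    "inventory (zero_inventory (schedule T T T 0)) t = real m * T + T - t"
    by (rule inventory_stationary[OF T t])
  have sch: "schedule T T T (1/2) (Suc k) = real k * T + T / 2" for k
    using T by (simp add: schedule_same algebra_simps)
  show ?thesis
  proof (cases "t < real m * T + T / 2")
    case True
    have "schedule T T T (1/2) m \<le> t"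
    \<comment> \<open>In the initial interval the current order of the shifted commodity is the
      shortened one at time 0.\<close>
    proof (cases m)
      case 0
      then show ?thesis using t facts(1) by simp
    next
      case (Suc k)
      then show ?thesis using m(1) T sch[of k] by (simp add: distrib_right)
    qed
    then have "inventory (zero_inventory (schedule T T T (1/2))) t = real m * T + T / 2 - t"
      using inventory_zero_inventory[OF facts, of m t] True sch[of m] by simp
    then show ?thesis using m by linarith
  next
    case False
    then have "inventory (zero_inventory (schedule T T T (1/2))) t = real m * T + T + T / 2 - t"
      using inventory_zero_inventory[OF facts, of "Suc m" t] T m sch[of m] sch[of "Suc m"]
      by (simp add: distrib_right)
    then show ?thesis using m False by linarith
  qed
qed

text \<open>The large commodity starts its period with full inventory, which the small commodity
  compensates with small orders. An order placed just before the middle of the period may already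
  be large, but by then the inventory of the large commodity is at most \<open>D / 2 + 7 / 9 * T\<close>.\<close>

lemma far_pair_peak:
  assumes T: "0 < T" and D: "28 * T < D" and t: "0 \<le> t"
  shows "inventory (zero_inventory (schedule D (7/9 * T) (5/4 * T) 0)) t / T
    + inventory (zero_inventory (schedule D D D 0)) t / D \<le> 16 / 9"
proof -
  have s: "(0::real) \<le> 0" "(0::real) < 1" by auto
  have pos: "0 < D" "0 < 7/9 * T" "7/9 * T \<le> 5/4 * T" using T D by auto
  obtain m where m: "real m * D \<le> t" "t < real m * D + D"
    "inventory (zero_inventory (schedule D D D 0)) t = real m * D + D - t"
    by (rule inventory_stationary[OF pos(1) t])
  define \<rho> where "\<rho> = t - real m * D"
  have large: "inventory (zero_inventory (schedule D D D 0)) t = D - \<rho>"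
    and \<rho>: "0 \<le> \<rho>" "t = real m * D + \<rho>"
    using m by (auto simp: \<rho>_def)
  show ?thesis
  proof (cases "\<rho> + 7/9 * T \<le> D / 2")
    case True
    then have "inventory (zero_inventory (schedule D (7/9 * T) (5/4 * T) 0)) t \<le> 7/9 * T"
      unfolding \<rho>(2) by (rule inventory_schedule_first_half_le[OF pos \<rho>(1)])
    then have "inventory (zero_inventory (schedule D (7/9 * T) (5/4 * T) 0)) t / T \<le> 7/9"
      using T by (simp add: field_simps)
    moreover have "(D - \<rho>) / D \<le> 1" using pos(1) \<rho> by simp
    ultimately show ?thesis unfolding large by linarith
  next
    case False
    have "inventory (zero_inventory (schedule D (7/9 * T) (5/4 * T) 0)) t \<le> 5/4 * T"
      by (rule inventory_schedule_le[OF pos s t])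
    then have "inventory (zero_inventory (schedule D (7/9 * T) (5/4 * T) 0)) t / T \<le> 5/4"
      using T by (simp add: field_simps)
    \<comment> \<open>The term \<open>7/9 * T\<close> is below \<open>D / 36\<close> because
      \<open>28 * T < D\<close>.\<close>
    moreover have "D - \<rho> \<le> (1/2 + 1/36) * D" using False D by simp
    then have "(D - \<rho>) / D \<le> 1/2 + 1/36" using pos(1) by (simp add: pos_divide_le_eq)
    ultimately show ?thesis unfolding large by linarith
  qed
qed


section \<open>Greedy pairing\<close>

text \<open>A ratio below 21/20 allows both commodities to use the smaller interval within the cost
  budget. A ratio above 28 makes a single small order negligible against the large period.\<close>

definition compatible :: "real \<Rightarrow> real \<Rightarrow> bool" where
  "compatible x y \<longleftrightarrow> 28 * x < y \<or> 28 * y < x \<or> x < 21/20 * y \<and> y < 21/20 * x"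

definition pair_up :: "(nat \<Rightarrow> real) \<Rightarrow> nat \<Rightarrow> nat \<Rightarrow> (nat \<Rightarrow> nat) \<Rightarrow> nat \<Rightarrow> nat" where
  "pair_up T a b \<sigma> =
     (if \<sigma> a = a \<and> \<sigma> b = b \<and> compatible (T a) (T b) then \<sigma>(a := b, b := a) else \<sigma>)"

definition pair_row :: "(nat \<Rightarrow> real) \<Rightarrow> nat \<Rightarrow> nat \<Rightarrow> (nat \<Rightarrow> nat) \<Rightarrow> nat \<Rightarrow> nat" where
  "pair_row T a b = fold (pair_up T a) [Suc a..<b]"

text \<open>Unpaired commodities are their own partners.\<close>

definition partner :: "(nat \<Rightarrow> real) \<Rightarrow> nat \<Rightarrow> nat \<Rightarrow> nat" where
  "partner T n = fold (\<lambda>a. pair_row T a n) [0..<n] id"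

definition pairing :: "(nat \<Rightarrow> real) \<Rightarrow> nat \<Rightarrow> (nat \<Rightarrow> nat) \<Rightarrow> bool" where
  "pairing T n \<sigma> \<longleftrightarrow>
     (\<forall>j<n. \<sigma> j < n \<and> \<sigma> (\<sigma> j) = j \<and> (\<sigma> j \<noteq> j \<longrightarrow> compatible (T j) (T (\<sigma> j))))"

lemma compatible_commute: "compatible x y \<longleftrightarrow> compatible y x"
  unfolding compatible_def by blast

lemma pairing_pair_up:
  assumes "pairing T n \<sigma>" "a < n" "b < n"
  shows "pairing T n (pair_up T a b \<sigma>)"
  unfolding pairing_def
proof (intro allI impI)
  fix j assume "j < n"
  then have j: "\<sigma> j < n" "\<sigma> (\<sigma> j) = j" "\<sigma> j \<noteq> j \<Longrightarrow> compatible (T j) (T (\<sigma> j))"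
    using assms(1) unfolding pairing_def by blast+
  show "pair_up T a b \<sigma> j < n \<and> pair_up T a b \<sigma> (pair_up T a b \<sigma> j) = j \<and>
      (pair_up T a b \<sigma> j \<noteq> j \<longrightarrow> compatible (T j) (T (pair_up T a b \<sigma> j)))"
  proof (cases "\<sigma> a = a \<and> \<sigma> b = b \<and> compatible (T a) (T b)")
    case True
    then have eq: "pair_up T a b \<sigma> = \<sigma>(a := b, b := a)" by (simp add: pair_up_def)
    have "\<sigma> j \<noteq> a" "\<sigma> j \<noteq> b" if "j \<noteq> a" "j \<noteq> b"
      using True j(2) that by metis+
    then show ?thesis
      unfolding eq using True j assms(2,3) compatible_commute[of "T a" "T b"] by simp
  next
    case False
    then have "pair_up T a b \<sigma> = \<sigma>" unfolding pair_up_def by meson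
    then show ?thesis using j by simp
  qed
qed

text \<open>Fixed points only disappear, so a commodity unpaired at the end was unpaired at every
  earlier test.\<close>

lemma pair_up_fixed: "a \<noteq> b \<Longrightarrow> pair_up T a b \<sigma> j = j \<Longrightarrow> \<sigma> j = j"
  by (simp add: pair_up_def split: if_split_asm)

lemma pair_row_Suc: "a < b \<Longrightarrow> pair_row T a (Suc b) \<sigma> = pair_up T a b (pair_row T a b \<sigma>)"
  by (simp add: pair_row_def)

text \<open>If \<open>a\<close> and \<open>c\<close> are both free after the row, they were free
  when they were tested against each other, so the test failed for lack of compatibility.\<close>

lemma pair_row:
  assumes "pairing T n \<sigma>" "a < b" "b \<le> n"
  shows "pairing T n (pair_row T a b \<sigma>) \<and> (\<forall>j. pair_row T a b \<sigma> j = j \<longrightarrow> \<sigma> j = j) \<and>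
    (\<forall>c. a < c \<longrightarrow> c < b \<longrightarrow> pair_row T a b \<sigma> a = a \<longrightarrow> pair_row T a b \<sigma> c = c \<longrightarrow>
       \<not> compatible (T a) (T c))"
proof -
  have "Suc a \<le> b" using assms by simp
  then show ?thesis using assms(3)
  proof (induction b rule: dec_induct)
    case base
    have "pair_row T a (Suc a) \<sigma> = \<sigma>" by (simp add: pair_row_def)
    with assms(1) show ?case by (metis not_less_eq)
  next
    case (step b)
    let ?\<sigma> = "pair_row T a b \<sigma>"
    have ab: "a < b" using step.hyps(1) by simp
    have bn: "b \<le> n" using step.prems by simp
    have IH: "pairing T n ?\<sigma>" "\<And>j. ?\<sigma> j = j \<Longrightarrow> \<sigma> j = j"
      "\<And>c. a < c \<Longrightarrow> c < b \<Longrightarrow> ?\<sigma> a = a \<Longrightarrow> ?\<sigma> c = c \<Longrightarrow> \<not> compatible (T a) (T c)"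
      using step.IH[OF bn] by blast+
    have fixed: "pair_up T a b ?\<sigma> j = j \<Longrightarrow> ?\<sigma> j = j" for j
      using pair_up_fixed[of a b] ab by blast
    have last: "\<not> compatible (T a) (T b)"
      if "pair_up T a b ?\<sigma> a = a" "pair_up T a b ?\<sigma> b = b"
    proof
      assume "compatible (T a) (T b)"
      then have "pair_up T a b ?\<sigma> = ?\<sigma>(a := b, b := a)"
        using fixed[OF that(1)] fixed[OF that(2)] unfolding pair_up_def by simp
      then have "pair_up T a b ?\<sigma> b = a" by simp
      with that(2) ab show False by simp
    qed
    show ?case
      unfolding pair_row_Suc[OF ab]
    proof (intro conjI allI impI)
      show "pairing T n (pair_up T a b ?\<sigma>)"
        by (rule pairing_pair_up[OF IH(1)]) (use ab step.prems in linarith)+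
      show "\<sigma> j = j" if "pair_up T a b ?\<sigma> j = j" for j
        using that fixed IH(2) by blast
      show "\<not> compatible (T a) (T c)"
        if "a < c" "c < Suc b" "pair_up T a b ?\<sigma> a = a" "pair_up T a b ?\<sigma> c = c" for c
        using that fixed IH(3) last by (metis less_Suc_eq)
    qed
  qed
qed

lemma partner_invariant:
  fixes T :: "nat \<Rightarrow> real"
  assumes "m \<le> n"
  defines "\<sigma> \<equiv> fold (\<lambda>a. pair_row T a n) [0..<m] id"
  shows "pairing T n \<sigma> \<and>
    (\<forall>a b. a < m \<longrightarrow> a < b \<longrightarrow> b < n \<longrightarrow> \<sigma> a = a \<longrightarrow> \<sigma> b = b \<longrightarrow> \<not> compatible (T a) (T b))"
  using assms(1) unfolding \<sigma>_def
proof (induction m)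
  case 0
  then show ?case by (simp add: pairing_def)
next
  case (Suc m)
  let ?\<sigma> = "fold (\<lambda>a. pair_row T a n) [0..<m] id"
  have m: "m \<le> n" using Suc.prems by simp
  have IH: "pairing T n ?\<sigma>"
    "\<And>a b. a < m \<Longrightarrow> a < b \<Longrightarrow> b < n \<Longrightarrow> ?\<sigma> a = a \<Longrightarrow> ?\<sigma> b = b \<Longrightarrow> \<not> compatible (T a) (T b)"
    using Suc.IH[OF m] by blast+
  have "fold (\<lambda>a. pair_row T a n) [0..<Suc m] id = pair_row T m n ?\<sigma>" by simp
  with pair_row[OF IH(1), of m n] IH(2) Suc.prems show ?case
    by (metis less_Suc_eq Suc_le_eq order_refl)
qed

lemma pairing_partner: "pairing T n (partner T n)"
  using partner_invariant[of n n T] by (simp add: partner_def)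

lemma unpaired_incompatible:
  assumes "a < n" "b < n" "a \<noteq> b" "partner T n a = a" "partner T n b = b"
  shows "\<not> compatible (T a) (T b)"
  using partner_invariant[of n n T] assms compatible_commute[of "T a" "T b"]
  by (metis order_refl linorder_neqE_nat partner_def)

text \<open>Distinct unpaired intervals differ by a factor of at least \<open>21 / 20\<close> and at most \<open>28\<close>,
  so their logarithms to base \<open>21 / 20\<close> are separated by \<open>1\<close> and lie in a bounded range.\<close>

lemma card_unpaired_le:
  assumes T: "\<And>j. j < n \<Longrightarrow> 0 < T j"
  shows "card {j. j < n \<and> partner T n j = j} \<le> 101"
proof (cases "{j. j < n \<and> partner T n j = j} = {}")
  case True
  show ?thesis unfolding True by simp
next
  case False
  define F where "F = {j. j < n \<and> partner T n j = j}"
  define b where "b = Min (T ` F)"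
  define g where "g j = nat \<lfloor>log (21/20) (T j / b)\<rfloor>" for j
  have fin: "finite F" by (simp add: F_def)
  have ne: "F \<noteq> {}" using False by (simp add: F_def)
  have "b \<in> T ` F" unfolding b_def using fin ne by (intro Min_in) auto
  then obtain m where m: "m \<in> F" "b = T m" by auto
  have b: "0 < b" using m T by (auto simp: F_def)
  have min: "b \<le> T j" if "j \<in> F" for j using that fin by (simp add: b_def)
  have incompat: "\<not> compatible (T i) (T j)" if "i \<in> F" "j \<in> F" "i \<noteq> j" for i j
    using that unpaired_incompatible by (auto simp: F_def)
  have log_ge: "0 \<le> log (21/20) (T j / b)" if "j \<in> F" for j
    using min[OF that] b by simp
  have "g j \<le> 100" if "j \<in> F" for j
  proof -
    \<comment> \<open>A larger interval would be compatible with that of \<open>m\<close>, which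
      attains the minimum \<open>b\<close>. The next estimate uses that
      \<open>28 < (21/20) ^ 100\<close>.\<close>
    have "T j \<le> 28 * b"
    proof (cases "j = m")
      case True
      then show ?thesis using b m by simp
    next
      case False
      then show ?thesis using incompat[of m j] that m by (auto simp: compatible_def)
    qed
    then have "T j / b \<le> (21/20) ^ 100"
      using b by (simp add: field_simps)
    then have "log (21/20) (T j / b) \<le> log (21/20) ((21/20) ^ 100)"
      using min[OF that] b by (intro log_mono) auto
    then have "log (21/20) (T j / b) \<le> 100"
      by (simp only: log_nat_power) (simp add: log_nat_power)
    then show ?thesis unfolding g_def by linarith
  qed
  then have "g ` F \<subseteq> {..100}" by auto
  moreover have "inj_on g F"
  proof (rule inj_onI, rule ccontr)
    fix i j assume ij: "i \<in> F" "j \<in> F" "g i = g j" "i \<noteq> j"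
    \<comment> \<open>Equal floors mean that the logarithms differ by less than 1. Applied in both
      directions this is the nearness clause of \<open>compatible\<close>.\<close>
    have lt: "T x < 21/20 * T y" if "x \<in> F" "y \<in> F" "g x = g y" for x y
    proof -
      have px: "0 < T x / b" "0 < T y / b" using min[OF that(1)] min[OF that(2)] b by auto
      have "\<lfloor>log (21/20) (T x / b)\<rfloor> = \<lfloor>log (21/20) (T y / b)\<rfloor>"
        using that log_ge[of x] log_ge[of y] by (simp add: g_def eq_nat_nat_iff)
      then have "log (21/20) (T x / b) < 1 + log (21/20) (T y / b)" by linarith
      also have "\<dots> = log (21/20) (21/20) + log (21/20) (T y / b)" by simp
      also have "\<dots> = log (21/20) (21/20 * (T y / b))"
        using px by (intro log_mult_pos[symmetric]) auto
      finally have "T x / b < 21/20 * (T y / b)"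
        using px by simp
      then show ?thesis using b by (simp add: field_simps)
    qed
    show False
      using incompat[OF ij(1,2,4)] lt[OF ij(1,2,3)] lt[OF ij(2,1) ij(3)[symmetric]]
      by (simp add: compatible_def)
  qed
  ultimately have "card F \<le> card {..100::nat}"
    by (intro card_inj_on_le) auto
  then show ?thesis by (simp add: F_def)
qed


section \<open>Total correctness with time bounds\<close>

text \<open>An upper bound instead of an exact step count lets branches of different lengths share
  one estimate.\<close>

definition runs :: "(nat \<Rightarrow> real) \<Rightarrow> prog \<Rightarrow> state \<Rightarrow> nat \<Rightarrow> (state \<Rightarrow> bool) \<Rightarrow> bool" where
  "runs \<omega> p s t Q \<longleftrightarrow> (\<exists>n s'. exec \<omega> p s n s' \<and> n \<le> t \<and> Q s')"

text \<open>There is no empty program, so the empty list becomes a dummy write to scratch register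
  50. It therefore does not match \<open>exec_block\<close>, whence the nonemptiness hypotheses
  below.\<close>

fun block :: "instr list \<Rightarrow> prog" where
  "block [] = Instr (Const 50 0)"
| "block [c] = Instr c"
| "block (c # cs) = Seq (Instr c) (block cs)"

fun exec_block :: "(nat \<Rightarrow> real) \<Rightarrow> instr list \<Rightarrow> state \<Rightarrow> state option" where
  "exec_block \<omega> [] s = Some s"
| "exec_block \<omega> (c # cs) s = Option.bind (step \<omega> c s) (exec_block \<omega> cs)"

lemma exec_block_exec:
  "exec_block \<omega> cs s = Some s' \<Longrightarrow> cs \<noteq> [] \<Longrightarrow> exec \<omega> (block cs) s (length cs) s'"
proof (induction cs arbitrary: s rule: block.induct)
  case 1
  then show ?case by simp
next
  case (2 c)
  then show ?case using exec.Instr[of \<omega> c s s'] by (auto split: bind_splits)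
next
  case (3 c d cs)
  then obtain s1 where "step \<omega> c s = Some s1" "exec_block \<omega> (d # cs) s1 = Some s'"
    by (auto split: bind_splits)
  with 3 have "exec \<omega> (Seq (Instr c) (block (d # cs))) s (1 + length (d # cs)) s'"
    by (intro exec.Seq exec.Instr) auto
  then show ?case by simp
qed

lemma runs_block:
  assumes "exec_block \<omega> cs s = Some s'" "cs \<noteq> []" "length cs \<le> t" "Q s'"
  shows "runs \<omega> (block cs) s t Q"
  using exec_block_exec[OF assms(1,2)] assms(3,4) unfolding runs_def by blast

lemma runs_mono:
  "runs \<omega> p s t Q \<Longrightarrow> t \<le> t' \<Longrightarrow> (\<And>s'. Q s' \<Longrightarrow> R s') \<Longrightarrow> runs \<omega> p s t' R"
  unfolding runs_def by (meson order_trans)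

lemma runs_Seq:
  assumes "runs \<omega> p s t P" "\<And>s'. P s' \<Longrightarrow> runs \<omega> q s' t' Q" "t + t' \<le> t''"
  shows "runs \<omega> (Seq p q) s t'' Q"
proof -
  obtain n s1 where 1: "exec \<omega> p s n s1" "n \<le> t" "P s1" using assms(1) by (auto simp: runs_def)
  obtain m s2 where 2: "exec \<omega> q s1 m s2" "m \<le> t'" "Q s2"
    using assms(2)[OF 1(3)] by (auto simp: runs_def)
  have "exec \<omega> (Seq p q) s (n + m) s2" using 1 2 by (intro exec.Seq)
  moreover have "n + m \<le> t''" using 1 2 assms(3) by simp
  ultimately show ?thesis using 2 unfolding runs_def by blast
qed

lemma runs_IfLess:
  assumes "regs s a < regs s b \<Longrightarrow> runs \<omega> p s t Q" "\<not> regs s a < regs s b \<Longrightarrow> runs \<omega> q s t Q"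
  shows "runs \<omega> (IfLess a b p q) s (Suc t) Q"
proof (cases "regs s a < regs s b")
  case True
  with assms(1) show ?thesis unfolding runs_def by (meson exec.IfTrue Suc_le_mono)
next
  case False
  with assms(2) show ?thesis unfolding runs_def by (meson exec.IfFalse Suc_le_mono)
qed

text \<open>The index \<open>j\<close> of the invariant bounds the remaining iterations. Each
  iteration lowers it by one, but the loop may exit early, at any \<open>j\<close>.\<close>

lemma runs_WhileLess:
  assumes body: "\<And>j s. Inv j s \<Longrightarrow> regs s a < regs s b \<Longrightarrow> \<exists>j'. j = Suc j' \<and> runs \<omega> p s t (Inv j')"
    and exit: "\<And>j s. Inv j s \<Longrightarrow> \<not> regs s a < regs s b \<Longrightarrow> Q s"
    and "Inv j s" "j * Suc t + 1 \<le> t'"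
  shows "runs \<omega> (WhileLess a b p) s t' Q"
proof -
  have "runs \<omega> (WhileLess a b p) s (j * Suc t + 1) Q"
    using assms(3)
  proof (induction j arbitrary: s)
    case 0
    then have "\<not> regs s a < regs s b" using body by blast
    then show ?case using exec.WhileFalse[of s a b \<omega> p] exit[OF 0] unfolding runs_def by auto
  next
    case (Suc j)
    show ?case
    proof (cases "regs s a < regs s b")
      case False
      then show ?thesis using exec.WhileFalse[of s a b \<omega> p] exit[OF Suc.prems] unfolding runs_def by auto
    next
      case True
      obtain n s1 where 1: "exec \<omega> p s n s1" "n \<le> t" "Inv j s1"
        using body[OF Suc.prems True] by (auto simp: runs_def)
      obtain m s2 where 2: "exec \<omega> (WhileLess a b p) s1 m s2" "m \<le> j * Suc t + 1" "Q s2"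
        using Suc.IH[OF 1(3)] by (auto simp: runs_def)
      have "exec \<omega> (WhileLess a b p) s (Suc (n + m)) s2" using exec.WhileTrue[OF True 1(1) 2(1)] .
      moreover have "Suc (n + m) \<le> Suc j * Suc t + 1" using 1(2) 2(2) by simp
      ultimately show ?thesis using 2(3) unfolding runs_def by blast
    qed
  qed
  then show ?thesis using assms(4) by (rule runs_mono)
qed


section \<open>The program for the pairing\<close>

definition skip :: prog where
  "skip = block [Const 50 0]"

text \<open>Registers 15 and 17 already hold the addresses of the partner cells of \<open>a\<close>
  and \<open>b\<close>.\<close>

definition store_pair :: prog where
  "store_pair = block [Sub 20 9 8, Store 15 20, Sub 20 8 9, Store 17 20]"

text \<open>Register 8 holds \<open>a\<close>, register 9 holds \<open>b\<close>, and heap cell \<open>4 * n + j\<close> holds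
  \<open>\<sigma> j - j\<close>. Hence the all-zero initial heap encodes the identity, and a sum of two squares
  tests that both \<open>a\<close> and \<open>b\<close> are unpaired.\<close>

definition pair_up_prog :: prog where
  "pair_up_prog =
     Seq (block [Add 15 7 8, Load 16 15, Add 17 7 9, Load 18 17,
                 Mul 19 16 16, Mul 20 18 18, Add 19 19 20,
                 Mul 20 11 8, Add 20 20 12, Load 21 20,
                 Mul 20 11 9, Add 20 20 12, Load 22 20,
                 Mul 23 13 21, Mul 24 13 22, Mul 25 14 21, Mul 26 14 22])
         (IfLess 19 6
            (IfLess 23 22 store_pair
               (IfLess 24 21 store_pair
                  (IfLess 21 26 (IfLess 22 25 store_pair skip) skip)))
            skip)"

definition partner_prog :: prog where
  "partner_prog =
     Seq (block [Const 6 1, Const 11 4, Const 12 3, Const 13 28, Const 14 (21/20), Mul 7 11 0])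
         (WhileLess 8 0
            (Seq (block [Add 9 8 6])
                 (Seq (WhileLess 9 0 (Seq pair_up_prog (block [Add 9 9 6])))
                      (block [Add 8 8 6]))))"

text \<open>The input occupies four heap cells per commodity, the interval being the last of them.
  Partner offsets start right behind the input, so stores never destroy data.\<close>

definition pairing_state :: "(nat \<Rightarrow> real) \<Rightarrow> nat \<Rightarrow> nat \<Rightarrow> nat \<Rightarrow> (nat \<Rightarrow> nat) \<Rightarrow> state \<Rightarrow> bool" where
  "pairing_state T n i k \<sigma> s \<longleftrightarrow>
     regs s 0 = real n \<and> regs s 4 = real i \<and> regs s 5 = real k \<and> regs s 6 = 1 \<and>
     regs s 7 = 4 * real n \<and> regs s 11 = 4 \<and> regs s 12 = 3 \<and> regs s 13 = 28 \<and> regs s 14 = 21/20 \<and>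
     (\<forall>j<n. heap s (4 * j + 3) = T j \<and> heap s (4 * n + j) = real (\<sigma> j) - real j)"

lemma address_simps:
  "4 * real n + real j \<in> \<nat>" "4 * real j + 3 \<in> \<nat>" "\<lfloor>4 * real n\<rfloor> = 4 * int n"
  "nat (4 * int n + int j) = 4 * n + j" "nat (4 * int j + 3) = 4 * j + 3"
proof -
  have 1: "4 * real n + real j = real (4 * n + j)" and 2: "4 * real j + 3 = real (4 * j + 3)"
    and 3: "4 * real n = real_of_int (4 * int n)" by auto
  show "4 * real n + real j \<in> \<nat>" "4 * real j + 3 \<in> \<nat>"
    unfolding 1 2 by (simp_all only: of_nat_in_Nats)
  show "\<lfloor>4 * real n\<rfloor> = 4 * int n" unfolding 3 by (rule floor_of_int)
qed auto

text \<open>The square of a nonzero integer is at least 1. One strict comparison thus decides two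
  equalities, for which the machine has no test.\<close>

lemma unpaired_test:
  fixes a b p q :: nat
  shows "(real p - real a) * (real p - real a) + (real q - real b) * (real q - real b) < 1
    \<longleftrightarrow> p = a \<and> q = b"
proof -
  have ge: "1 \<le> (real x - real y) * (real x - real y)" if "x \<noteq> y" for x y :: nat
  proof -
    have "1 \<le> \<bar>int x - int y\<bar>" using that by simp
    then have "1 * 1 \<le> \<bar>int x - int y\<bar> * \<bar>int x - int y\<bar>" by (intro mult_mono) auto
    then have "1 \<le> (int x - int y) * (int x - int y)" by (simp add: abs_mult_self_eq)
    then have "real_of_int 1 \<le> real_of_int ((int x - int y) * (int x - int y))"
      by (simp only: of_int_le_iff)
    then show ?thesis by simp
  qed
  show ?thesis
    using ge[of p a] ge[of q b] zero_le_square[of "real p - real a"] zero_le_square[of "real q - real b"]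
    by (cases "p = a"; cases "q = b") auto
qed

lemma runs_skip: "(\<And>x. Q (set_reg 50 x s)) \<Longrightarrow> 1 \<le> t \<Longrightarrow> runs \<omega> skip s t Q"
  unfolding skip_def by (rule runs_block) auto

lemma runs_store_pair:
  assumes "pairing_state T n i k \<sigma> s" "a < b" "b < n"
    "regs s 8 = real a" "regs s 9 = real b"
    "regs s 15 = 4 * real n + real a" "regs s 17 = 4 * real n + real b" "4 \<le> t"
  shows "runs \<omega> store_pair s t
    (\<lambda>s'. pairing_state T n i k (\<sigma>(a := b, b := a)) s' \<and> regs s' 8 = real a \<and> regs s' 9 = real b)"
  unfolding store_pair_def
proof (rule runs_block)
  show "exec_block \<omega> [Sub 20 9 8, Store 15 20, Sub 20 8 9, Store 17 20] s =
    Some (s\<lparr>regs := (regs s)(20 := real a - real b),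
      heap := (heap s)(4 * n + a := real b - real a, 4 * n + b := real a - real b)\<rparr>)"
    using assms by (simp add: set_reg_def address_simps)
qed (use assms in \<open>auto simp: pairing_state_def\<close>)

lemma runs_pair_up:
  assumes "pairing_state T n i k \<sigma> s" "a < b" "b < n" "regs s 8 = real a" "regs s 9 = real b"
  shows "runs \<omega> pair_up_prog s 26
    (\<lambda>s'. pairing_state T n i k (pair_up T a b \<sigma>) s' \<and> regs s' 8 = real a \<and> regs s' 9 = real b)"
  unfolding pair_up_prog_def
proof (rule runs_Seq)
  let ?P = "\<lambda>s'. pairing_state T n i k \<sigma> s' \<and> regs s' 8 = real a \<and> regs s' 9 = real b \<and>
    regs s' 15 = 4 * real n + real a \<and> regs s' 17 = 4 * real n + real b \<and>
    regs s' 19 = (real (\<sigma> a) - real a) * (real (\<sigma> a) - real a)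
       + (real (\<sigma> b) - real b) * (real (\<sigma> b) - real b) \<and>
    regs s' 21 = T a \<and> regs s' 22 = T b \<and> regs s' 23 = 28 * T a \<and> regs s' 24 = 28 * T b \<and>
    regs s' 25 = 21/20 * T a \<and> regs s' 26 = 21/20 * T b"
  show "runs \<omega> (block [Add 15 7 8, Load 16 15, Add 17 7 9, Load 18 17,
                 Mul 19 16 16, Mul 20 18 18, Add 19 19 20,
                 Mul 20 11 8, Add 20 20 12, Load 21 20,
                 Mul 20 11 9, Add 20 20 12, Load 22 20,
                 Mul 23 13 21, Mul 24 13 22, Mul 25 14 21, Mul 26 14 22]) s 17 ?P"
    apply (rule runs_block)
    using assms
       apply (simp add: pairing_state_def set_reg_def address_simps)
    using assms apply (auto simp: pairing_state_def)
    done
  fix s' assume P: "?P s'"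
  note store = runs_store_pair[where s = s' and T = T and n = n and i = i and k = k and \<sigma> = \<sigma>
      and a = a and b = b and \<omega> = \<omega>]
  have cond: "regs s' 19 < regs s' 6 \<longleftrightarrow> \<sigma> a = a \<and> \<sigma> b = b"
    "compatible (T a) (T b) \<longleftrightarrow> regs s' 23 < regs s' 22 \<or> regs s' 24 < regs s' 21 \<or>
       regs s' 21 < regs s' 26 \<and> regs s' 22 < regs s' 25"
  proof -
    have r: "regs s' 21 = T a" "regs s' 22 = T b" "regs s' 23 = 28 * T a" "regs s' 24 = 28 * T b"
      "regs s' 25 = 21/20 * T a" "regs s' 26 = 21/20 * T b"
      using P by blast+
    show "regs s' 19 < regs s' 6 \<longleftrightarrow> \<sigma> a = a \<and> \<sigma> b = b"
      using P by (simp add: pairing_state_def unpaired_test)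
    show "compatible (T a) (T b) \<longleftrightarrow> regs s' 23 < regs s' 22 \<or> regs s' 24 < regs s' 21 \<or>
       regs s' 21 < regs s' 26 \<and> regs s' 22 < regs s' 25"
      by (simp only: compatible_def r)
  qed
  \<comment> \<open>At most five nested tests are evaluated, followed by the four instructions of
    \<open>store_pair\<close>.\<close>
  show "runs \<omega> (IfLess 19 6
            (IfLess 23 22 store_pair
               (IfLess 24 21 store_pair
                  (IfLess 21 26 (IfLess 22 25 store_pair skip) skip)))
            skip) s' (Suc (Suc (Suc (Suc (Suc 4)))))
    (\<lambda>s'. pairing_state T n i k (pair_up T a b \<sigma>) s' \<and> regs s' 8 = real a \<and> regs s' 9 = real b)"
    (is "runs _ _ _ _ ?Q")
  proof (cases "\<sigma> a = a \<and> \<sigma> b = b \<and> compatible (T a) (T b)")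
    case True
    then have eq: "pair_up T a b \<sigma> = \<sigma>(a := b, b := a)" by (simp add: pair_up_def)
    have st: "runs \<omega> store_pair s' t ?Q" if "4 \<le> t" for t
      unfolding eq by (rule store) (use P that assms(2,3) in auto)
    show ?thesis
      by (intro runs_IfLess; ((rule st; simp) | (use cond True in blast)))
  next
    case False
    then have eq: "pair_up T a b \<sigma> = \<sigma>" unfolding pair_up_def by meson
    have sk: "runs \<omega> skip s' t ?Q" if "1 \<le> t" for t
      unfolding eq by (rule runs_skip) (use P that in \<open>auto simp: pairing_state_def set_reg_def\<close>)
    show ?thesis
      by (intro runs_IfLess; ((rule sk; simp) | (use cond False in blast)))
  qed
qed simp

text \<open>An iteration costs 26 for \<open>pair_up_prog\<close>, 1 for the increment and 1 for the
  test.\<close>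

lemma runs_pair_row:
  assumes "pairing_state T n i k \<sigma> s" "a < n" "regs s 8 = real a" "regs s 9 = real (Suc a)"
  shows "runs \<omega> (WhileLess 9 0 (Seq pair_up_prog (block [Add 9 9 6]))) s (n * 28 + 1)
    (\<lambda>s'. pairing_state T n i k (pair_row T a n \<sigma>) s' \<and> regs s' 8 = real a)"
proof -
  let ?Inv = "\<lambda>j s. \<exists>b. b + j = n \<and> a < b \<and> pairing_state T n i k (pair_row T a b \<sigma>) s \<and>
    regs s 8 = real a \<and> regs s 9 = real b"
  have row: "pair_row T a (Suc a) \<sigma> = \<sigma>" by (simp add: pair_row_def)
  have start: "?Inv (n - Suc a) s"
    by (rule exI[of _ "Suc a"], unfold row) (use assms in \<open>intro conjI; simp\<close>)
  show ?thesis
  proof (rule runs_WhileLess[where Inv = ?Inv, OF _ _ start])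
    show "(n - Suc a) * Suc 27 + 1 \<le> n * 28 + 1" by simp
    show "pairing_state T n i k (pair_row T a n \<sigma>) s \<and> regs s 8 = real a"
      if inv: "?Inv j s" and less: "\<not> regs s 9 < regs s 0" for j s
    proof -
      obtain b where b: "b + j = n" "pairing_state T n i k (pair_row T a b \<sigma>) s"
        "regs s 8 = real a" "regs s 9 = real b"
        using inv by blast
      then have "b = n" using less by (simp add: pairing_state_def)
      then show ?thesis using b by simp
    qed
    show "\<exists>j'. j = Suc j' \<and> runs \<omega> (Seq pair_up_prog (block [Add 9 9 6])) s 27 (?Inv j')"
      if inv: "?Inv j s" and less: "regs s 9 < regs s 0" for j s
    proof -
      obtain b where b: "b + j = n" "a < b" "pairing_state T n i k (pair_row T a b \<sigma>) s"
        "regs s 8 = real a" "regs s 9 = real b"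
        using inv by blast
      then have "b < n" using less by (simp add: pairing_state_def)
      then obtain j' where j: "j = Suc j'" using b by (cases j) auto
      have "runs \<omega> (Seq pair_up_prog (block [Add 9 9 6])) s 27 (?Inv j')"
      proof (rule runs_Seq[OF runs_pair_up[OF b(3,2) \<open>b < n\<close> b(4,5)]])
        fix s' assume s': "pairing_state T n i k (pair_up T a b (pair_row T a b \<sigma>)) s' \<and>
          regs s' 8 = real a \<and> regs s' 9 = real b"
        show "runs \<omega> (block [Add 9 9 6]) s' 1 (?Inv j')"
        proof (rule runs_block)
          show "exec_block \<omega> [Add 9 9 6] s' = Some (set_reg 9 (real (Suc b)) s')"
            using s' by (simp add: pairing_state_def add.commute)
          show "?Inv j' (set_reg 9 (real (Suc b)) s')"
            using s' b j by (intro exI[of _ "Suc b"]) (auto simp: pair_row_Suc pairing_state_def set_reg_def)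
        qed auto
      qed simp
      with j show ?thesis by blast
    qed
  qed
qed

text \<open>Six initial instructions and the final failing test give 7. An outer iteration costs
  \<open>28 * n + 1\<close> for the row, two increments and a test.\<close>

lemma runs_partner:
  assumes "regs s 0 = real n" "regs s 4 = real i" "regs s 5 = real k" "regs s 8 = 0"
    "\<And>j. j < n \<Longrightarrow> heap s (4 * j + 3) = T j" "\<And>j. j < n \<Longrightarrow> heap s (4 * n + j) = 0"
  shows "runs \<omega> partner_prog s (7 + n * (28 * n + 4)) (pairing_state T n i k (partner T n))"
  unfolding partner_prog_def
proof (rule runs_Seq)
  show "runs \<omega> (block [Const 6 1, Const 11 4, Const 12 3, Const 13 28, Const 14 (21/20), Mul 7 11 0]) s 6
     (\<lambda>s'. pairing_state T n i k id s' \<and> regs s' 8 = 0)"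
    apply (rule runs_block)
       apply simp
      apply simp
     apply simp
    using assms by (simp add: pairing_state_def set_reg_def of_rat_divide)
  fix s' assume s': "pairing_state T n i k id s' \<and> regs s' 8 = 0"
  let ?\<sigma> = "\<lambda>a. fold (\<lambda>a. pair_row T a n) [0..<a] id"
  let ?Inv = "\<lambda>j s. \<exists>a. a + j = n \<and> pairing_state T n i k (?\<sigma> a) s \<and> regs s 8 = real a"
  let ?body = "Seq (block [Add 9 8 6])
      (Seq (WhileLess 9 0 (Seq pair_up_prog (block [Add 9 9 6]))) (block [Add 8 8 6]))"
  show "runs \<omega> (WhileLess 8 0 ?body) s' (1 + n * (28 * n + 4)) (pairing_state T n i k (partner T n))"
  proof (rule runs_WhileLess[where Inv = ?Inv])
    show "?Inv n s'" using s' by auto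
    show "n * Suc (28 * n + 3) + 1 \<le> 1 + n * (28 * n + 4)" by simp
    show "pairing_state T n i k (partner T n) s"
      if inv: "?Inv j s" and less: "\<not> regs s 8 < regs s 0" for j s
    proof -
      obtain a where a: "a + j = n" "pairing_state T n i k (?\<sigma> a) s" "regs s 8 = real a"
        using inv by blast
      then have "a = n" using less by (simp add: pairing_state_def)
      then show ?thesis using a by (simp add: partner_def)
    qed
    show "\<exists>j'. j = Suc j' \<and> runs \<omega> ?body s (28 * n + 3) (?Inv j')"
      if inv: "?Inv j s" and less: "regs s 8 < regs s 0" for j s
    proof -
      obtain a where a: "a + j = n" "pairing_state T n i k (?\<sigma> a) s" "regs s 8 = real a"
        using inv by blast
      then have "a < n" using less by (simp add: pairing_state_def)
      then obtain j' where j: "j = Suc j'" using a by (cases j) auto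
      have "runs \<omega> ?body s (28 * n + 3) (?Inv j')"
      proof (rule runs_Seq[where t = 1 and t' = "28 * n + 2"])
        show "runs \<omega> (block [Add 9 8 6]) s 1
          (\<lambda>s'. pairing_state T n i k (?\<sigma> a) s' \<and> regs s' 8 = real a \<and> regs s' 9 = real (Suc a))"
          using a(2,3) by (intro runs_block) (auto simp: pairing_state_def set_reg_def)
        fix s1 assume s1: "pairing_state T n i k (?\<sigma> a) s1 \<and> regs s1 8 = real a \<and> regs s1 9 = real (Suc a)"
        show "runs \<omega> (Seq (WhileLess 9 0 (Seq pair_up_prog (block [Add 9 9 6]))) (block [Add 8 8 6]))
            s1 (28 * n + 2) (?Inv j')"
        proof (rule runs_Seq[OF runs_pair_row[of T n i k "?\<sigma> a" s1 a]])
          fix s2 assume s2: "pairing_state T n i k (pair_row T a n (?\<sigma> a)) s2 \<and> regs s2 8 = real a"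
          show "runs \<omega> (block [Add 8 8 6]) s2 1 (?Inv j')"
          proof (rule runs_block)
            show "exec_block \<omega> [Add 8 8 6] s2 = Some (set_reg 8 (real (Suc a)) s2)"
              using s2 by (simp add: pairing_state_def add.commute)
            show "?Inv j' (set_reg 8 (real (Suc a)) s2)"
              using s2 a j by (intro exI[of _ "Suc a"]) (auto simp: pairing_state_def set_reg_def)
          qed auto
        qed (use s1 \<open>a < n\<close> in auto)
      qed simp
      with j show ?thesis by blast
    qed
  qed
qed simp


section \<open>The program for the order times\<close>

text \<open>Reads \<open>k\<close> from register 5 and the schedule from registers 30 to 38 and leaves the order
  time in register 40. The remainder modulo the period is found by doubling and halving. It may end
  up equal to the full period, which is harmless because \<open>small_orders\<close> is continuous.\<close>

definition order_time_prog :: prog where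
  "order_time_prog =
     Seq (block [Sub 41 5 33])
    (Seq (IfLess 41 38 (block [Const 41 0]) skip)
    (Seq (block [Mul 42 6 41, Mul 43 6 35])
    (Seq (WhileLess 43 42 (block [Add 43 43 43]))
    (Seq (WhileLess 35 43
           (Seq (block [Mul 43 43 37]) (IfLess 42 43 skip (block [Sub 42 42 43]))))
    (Seq (IfLess 42 34 (block [Mul 44 6 42]) (block [Mul 44 6 34]))
         (block [Sub 45 41 42, Divide 45 45 35, Mul 45 45 34, Add 45 45 44,
                 Mul 46 32 41, Mul 45 36 45, Sub 40 46 45]))))))"

definition schedule_state :: "real \<Rightarrow> real \<Rightarrow> real \<Rightarrow> real \<Rightarrow> nat \<Rightarrow> state \<Rightarrow> bool" where
  "schedule_state D u v s k st \<longleftrightarrow>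
     regs st 5 = real k \<and> regs st 6 = 1 \<and> regs st 30 = D \<and> regs st 31 = u \<and> regs st 32 = v \<and>
     regs st 33 = s \<and> regs st 34 = small_count D u \<and> regs st 35 = period_count D u v \<and>
     regs st 36 = v - u \<and> regs st 37 = 1/2 \<and> regs st 38 = 0"

text \<open>Registers from 40 on are scratch. Since the others survive, the order-time program can
  be run a second time for the next order.\<close>

definition agree :: "state \<Rightarrow> state \<Rightarrow> bool" where
  "agree st st' \<longleftrightarrow> (\<forall>r<40. regs st' r = regs st r)"

lemma agree_regs:
  assumes "agree st st'"
  shows "regs st' 0 = regs st 0" "regs st' 5 = regs st 5" "regs st' 6 = regs st 6"
    "regs st' 30 = regs st 30" "regs st' 31 = regs st 31" "regs st' 32 = regs st 32"
    "regs st' 33 = regs st 33" "regs st' 34 = regs st 34" "regs st' 35 = regs st 35"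
    "regs st' 36 = regs st 36" "regs st' 37 = regs st 37" "regs st' 38 = regs st 38"
  using assms by (auto simp: agree_def)

text \<open>Since the period is at least 1 and the index at most \<open>2 ^ J\<close>, at most
  \<open>J\<close> doublings reach the index. Halving back and subtracting when possible is binary
  long division, so the time is logarithmic in \<open>k\<close>, as the query size demands.\<close>

lemma runs_order_time:
  assumes st: "schedule_state D u v s k st" and D: "0 < D" and u: "0 < u" and uv: "u \<le> v"
    and s: "0 \<le> s" and N: "1 \<le> period_count D u v" and J: "real k \<le> 2 ^ J"
  shows "runs \<omega> order_time_prog st (20 + 7 * J) (\<lambda>st'. regs st' 40 = schedule D u v s k \<and> agree st st')"
  unfolding order_time_prog_def
proof -
  define x where "x = max 0 (real k - s)"
  define N where "N = period_count D u v"
  have "real k - s \<le> 2 ^ J" using s J by linarith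
  then have x: "0 \<le> x" "x \<le> 2 ^ J" by (simp_all add: x_def)
  have N1: "1 \<le> N" using assms by (simp add: N_def)
  have st': "regs st 5 = real k" "regs st 6 = 1" "regs st 30 = D" "regs st 31 = u" "regs st 32 = v"
    "regs st 33 = s" "regs st 34 = small_count D u" "regs st 35 = N"
    "regs st 36 = v - u" "regs st 37 = 1/2" "regs st 38 = 0"
    using st by (auto simp: schedule_state_def N_def)
  have regs: "regs a 5 = real k" "regs a 6 = 1" "regs a 30 = D" "regs a 31 = u" "regs a 32 = v"
    "regs a 33 = s" "regs a 34 = small_count D u" "regs a 35 = N"
    "regs a 36 = v - u" "regs a 37 = 1/2" "regs a 38 = 0" if "agree st a" for a
    using st' agree_regs[OF that] by auto
  let ?P1 = "\<lambda>a. agree st a \<and> regs a 41 = real k - s"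
  let ?P2 = "\<lambda>a. agree st a \<and> regs a 41 = x"
  let ?P3 = "\<lambda>a. agree st a \<and> regs a 41 = x \<and> regs a 42 = x \<and> regs a 43 = N"
  let ?I4 = "\<lambda>j a. agree st a \<and> regs a 41 = x \<and> regs a 42 = x \<and>
    (\<exists>i. i + j = J \<and> regs a 43 = 2 ^ i * N)"
  let ?P4 = "\<lambda>a. agree st a \<and> regs a 41 = x \<and> regs a 42 = x \<and>
    (\<exists>i\<le>J. regs a 43 = 2 ^ i * N \<and> x \<le> 2 ^ i * N)"
  \<comment> \<open>The quotient \<open>q\<close> exists only in the invariant; the program recovers
    it at the end by the exact division \<open>(x - r) / N\<close>, where \<open>r\<close> is the
    remainder.\<close>
  let ?I5 = "\<lambda>j a. agree st a \<and> regs a 41 = x \<and> regs a 43 = 2 ^ j * N \<and>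
    (\<exists>q::nat. x = real q * N + regs a 42 \<and> 0 \<le> regs a 42 \<and> regs a 42 \<le> 2 ^ j * N)"
  let ?P5 = "\<lambda>a. agree st a \<and> regs a 41 = x \<and>
    (\<exists>q::nat. x = real q * N + regs a 42 \<and> 0 \<le> regs a 42 \<and> regs a 42 \<le> N)"
  let ?P6 = "\<lambda>a. ?P5 a \<and> regs a 44 = min (regs a 42) (small_count D u)"
  have 1: "runs \<omega> (block [Sub 41 5 33]) st 1 ?P1"
    by (intro runs_block) (auto simp: set_reg_def agree_def st')
  have 2: "runs \<omega> (IfLess 41 38 (block [Const 41 0]) skip) a (Suc 1) ?P2" if "?P1 a" for a
  proof (rule runs_IfLess)
    assume "regs a 41 < regs a 38"
    then show "runs \<omega> (block [Const 41 0]) a 1 ?P2"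
      using that regs by (intro runs_block) (auto simp: set_reg_def agree_def x_def)
  next
    assume "\<not> regs a 41 < regs a 38"
    then show "runs \<omega> skip a 1 ?P2"
      using that regs by (intro runs_skip) (auto simp: set_reg_def agree_def x_def)
  qed
  have 3: "runs \<omega> (block [Mul 42 6 41, Mul 43 6 35]) a 2 ?P3" if "?P2 a" for a
    using that regs[of a] by (intro runs_block) (auto simp: set_reg_def agree_def)
  have 4: "runs \<omega> (WhileLess 43 42 (block [Add 43 43 43])) a (J * 2 + 1) ?P4" if P3: "?P3 a" for a
  proof (rule runs_WhileLess[where Inv = ?I4 and t = 1 and j = J])
    show "?I4 J a" using P3 by auto
    show "J * Suc 1 + 1 \<le> J * 2 + 1" by simp
    show "?P4 b" if inv: "?I4 j b" and less: "\<not> regs b 43 < regs b 42" for j b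
    proof -
      obtain i where "i + j = J" "regs b 43 = 2 ^ i * N" using inv by blast
      then show ?thesis using inv less by (intro conjI exI[of _ i]) auto
    qed
    show "\<exists>j'. j = Suc j' \<and> runs \<omega> (block [Add 43 43 43]) b 1 (?I4 j')"
      if inv: "?I4 j b" and less: "regs b 43 < regs b 42" for j b
    proof -
      obtain i where i: "i + j = J" "regs b 43 = 2 ^ i * N" using inv by blast
      have "2 ^ i * 1 \<le> 2 ^ i * N" using N1 by (intro mult_left_mono) auto
      moreover have "2 ^ i * N < x" using i inv less by simp
      ultimately have "(2::real) ^ i < 2 ^ J" using x(2) by linarith
      then have "i < J" by simp
      then obtain j' where j: "j = Suc j'" using i by (cases j) auto
      have "runs \<omega> (block [Add 43 43 43]) b 1 (?I4 j')"
      proof (rule runs_block)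
        show "exec_block \<omega> [Add 43 43 43] b = Some (set_reg 43 (2 ^ Suc i * N) b)"
          using i by (simp add: algebra_simps)
        show "?I4 j' (set_reg 43 (2 ^ Suc i * N) b)"
          using inv i(1) j by (intro conjI exI[of _ "Suc i"]) (auto simp: agree_def set_reg_def)
      qed auto
      with j show ?thesis by blast
    qed
  qed
  have 5: "runs \<omega> (WhileLess 35 43
      (Seq (block [Mul 43 43 37]) (IfLess 42 43 skip (block [Sub 42 42 43])))) a (J * 4 + 1) ?P5"
    if P4: "?P4 a" for a
  proof -
    obtain i where i: "i \<le> J" "regs a 43 = 2 ^ i * N" "x \<le> 2 ^ i * N" using P4 by blast
    show ?thesis
    proof (rule runs_WhileLess[where Inv = ?I5 and t = 3 and j = i])
      show "?I5 i a" using P4 i x by (intro conjI exI[of _ 0]) auto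
      show "i * Suc 3 + 1 \<le> J * 4 + 1" using i by simp
      show "?P5 b" if inv: "?I5 j b" and less: "\<not> regs b 35 < regs b 43" for j b
      proof -
        have "2 ^ j * N \<le> 1 * N" using inv less regs[of b] by simp
        then have "(2::real) ^ j \<le> 1" using N1 by (simp add: mult_le_cancel_right)
        moreover have "1 < (2::real) ^ j" if "j \<noteq> 0" using that by (intro one_less_power) auto
        ultimately have "j = 0" by linarith
        then show ?thesis using inv by simp
      qed
      show "\<exists>j'. j = Suc j' \<and> runs \<omega>
          (Seq (block [Mul 43 43 37]) (IfLess 42 43 skip (block [Sub 42 42 43]))) b 3 (?I5 j')"
        if inv: "?I5 j b" and less: "regs b 35 < regs b 43" for j b
      proof -
        have "j \<noteq> 0" using inv less regs[of b] by (intro notI) simp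
        then obtain j' where j: "j = Suc j'" by (cases j) auto
        obtain q :: nat where q: "x = real q * N + regs b 42" "0 \<le> regs b 42" "regs b 42 \<le> 2 ^ j * N"
          using inv by blast
        have "runs \<omega> (Seq (block [Mul 43 43 37]) (IfLess 42 43 skip (block [Sub 42 42 43])))
            b 3 (?I5 j')"
        proof (rule runs_Seq)
          show "runs \<omega> (block [Mul 43 43 37]) b 1 (\<lambda>c. agree st c \<and> regs c 41 = x \<and>
              regs c 43 = 2 ^ j' * N \<and> regs c 42 = regs b 42)"
            using inv regs[of b] j by (intro runs_block) (auto simp: set_reg_def agree_def)
          fix c assume c: "agree st c \<and> regs c 41 = x \<and>
              regs c 43 = 2 ^ j' * N \<and> regs c 42 = regs b 42"
          show "runs \<omega> (IfLess 42 43 skip (block [Sub 42 42 43])) c (Suc 1) (?I5 j')"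
          proof (rule runs_IfLess)
            assume less: "regs c 42 < regs c 43"
            show "runs \<omega> skip c 1 (?I5 j')"
            proof (rule runs_skip)
              show "?I5 j' (set_reg 50 y c)" for y
                using c q less by (intro conjI exI[of _ q]) (auto simp: agree_def set_reg_def)
            qed simp
          next
            assume less: "\<not> regs c 42 < regs c 43"
            show "runs \<omega> (block [Sub 42 42 43]) c 1 (?I5 j')"
            proof (rule runs_block)
              show "exec_block \<omega> [Sub 42 42 43] c = Some (set_reg 42 (regs b 42 - 2 ^ j' * N) c)"
                using c by simp
              show "?I5 j' (set_reg 42 (regs b 42 - 2 ^ j' * N) c)"
                using c q less j
                \<comment> \<open>Subtracting \<open>2 ^ j' * N\<close> from the remainder moves
                  \<open>2 ^ j'\<close> periods into the quotient.\<close>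
                by (intro conjI exI[of _ "q + 2 ^ j'"]) (auto simp: agree_def set_reg_def algebra_simps)
            qed auto
          qed
        qed simp
        with j show ?thesis by blast
      qed
    qed
  qed
  have 6: "runs \<omega> (IfLess 42 34 (block [Mul 44 6 42]) (block [Mul 44 6 34])) a (Suc 1) ?P6"
    if P5: "?P5 a" for a
  proof (rule runs_IfLess)
    obtain q :: nat where q: "x = real q * N + regs a 42" "0 \<le> regs a 42" "regs a 42 \<le> N"
      using P5 by blast
    show "runs \<omega> (block [Mul 44 6 42]) a 1 ?P6" if "regs a 42 < regs a 34"
    proof (rule runs_block)
      show "?P6 (set_reg 44 (regs a 42) a)"
        using P5 q that regs[of a] by (intro conjI exI[of _ q]) (auto simp: agree_def set_reg_def)
    qed (use P5 regs[of a] in auto)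
    show "runs \<omega> (block [Mul 44 6 34]) a 1 ?P6" if "\<not> regs a 42 < regs a 34"
    proof (rule runs_block)
      show "?P6 (set_reg 44 (regs a 34) a)"
        using P5 q that regs[of a] by (intro conjI exI[of _ q]) (auto simp: agree_def set_reg_def)
    qed (use P5 regs[of a] in auto)
  qed
  have 7: "runs \<omega> (block [Sub 45 41 42, Divide 45 45 35, Mul 45 45 34, Add 45 45 44,
      Mul 46 32 41, Mul 45 36 45, Sub 40 46 45]) a 7
      (\<lambda>st'. regs st' 40 = schedule D u v s k \<and> agree st st')" if P6: "?P6 a" for a
  proof -
    obtain q :: nat where q: "x = real q * N + regs a 42" "0 \<le> regs a 42" "regs a 42 \<le> N"
      using P6 by blast
    have "small_orders D u v x = (x - regs a 42) / N * small_count D u + regs a 44"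
      using small_orders_eq[OF D u uv, of "regs a 42" "int q"] q P6 N1 by (simp add: N_def)
    then have sch: "schedule D u v s k =
        v * x - (v - u) * ((x - regs a 42) / N * small_count D u + regs a 44)"
      unfolding schedule_def order_position_def x_def by simp
    show ?thesis
      unfolding sch using P6 regs[of a] N1
      by (intro runs_block) (auto simp: set_reg_def agree_def)
  qed
  show "runs \<omega> (Seq (block [Sub 41 5 33])
    (Seq (IfLess 41 38 (block [Const 41 0]) skip)
    (Seq (block [Mul 42 6 41, Mul 43 6 35])
    (Seq (WhileLess 43 42 (block [Add 43 43 43]))
    (Seq (WhileLess 35 43
           (Seq (block [Mul 43 43 37]) (IfLess 42 43 skip (block [Sub 42 42 43]))))
    (Seq (IfLess 42 34 (block [Mul 44 6 42]) (block [Mul 44 6 34]))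
         (block [Sub 45 41 42, Divide 45 45 35, Mul 45 45 34, Add 45 45 44,
                 Mul 46 32 41, Mul 45 36 45, Sub 40 46 45]))))))) st (20 + 7 * J)
     (\<lambda>st'. regs st' 40 = schedule D u v s k \<and> agree st st')"
    by (rule runs_Seq[OF 1], rule runs_Seq[OF 2], assumption, rule runs_Seq[OF 3], assumption,
        rule runs_Seq[OF 4], assumption, rule runs_Seq[OF 5], assumption,
        rule runs_Seq[OF 6], assumption, erule 7) auto
qed


section \<open>The policy\<close>

text \<open>The components are \<open>D\<close>, \<open>u\<close>, \<open>v\<close>,
  \<open>s\<close> of \<open>schedule\<close>; equal \<open>u\<close> and \<open>v\<close> give a
  stationary policy. The flag \<open>late\<close> breaks the symmetry of a near pair, so that
  exactly one partner is shifted. An unpaired commodity gets the plan with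
  \<open>x = y\<close>.\<close>

definition plan :: "real \<Rightarrow> real \<Rightarrow> bool \<Rightarrow> real \<times> real \<times> real \<times> real" where
  "plan x y late =
     (if 28 * x < y then (y, 7/9 * x, 5/4 * x, 0)
      else if 28 * y < x then (x, x, x, 0)
      else (min x y, min x y, min x y, if late then 1/2 else 0))"

definition plan_policy :: "real \<times> real \<times> real \<times> real \<Rightarrow> policy" where
  "plan_policy = (\<lambda>(D, u, v, s). zero_inventory (schedule D u v s))"

definition commodity_policy :: "(nat \<Rightarrow> real) \<Rightarrow> nat \<Rightarrow> nat \<Rightarrow> policy" where
  "commodity_policy T n i =
     plan_policy (plan (T i) (T (partner T n i)) (partner T n i < i))"

text \<open>The last conclusion bounds the doublings of the program. A stationary plan has period
  count exactly \<open>1/2 + 1/2\<close>; in the far case the small phase alone contains more than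
  18 orders.\<close>

lemma plan_valid:
  assumes "0 < x" "0 < y" "plan x y late = (D, u, v, s)"
  shows "0 < D" "0 < u" "u \<le> v" "0 \<le> s" "s < 1" "1 \<le> period_count D u v"
proof -
  consider "28 * x < y" "D = y" "u = 7/9 * x" "v = 5/4 * x" "s = 0"
    | "D = u" "v = u" "u = min x y \<or> u = x" "s = 0 \<or> s = 1/2"
    using assms(3) by (auto simp: plan_def split: if_splits)
  then have "0 < D \<and> 0 < u \<and> u \<le> v \<and> 0 \<le> s \<and> s < 1 \<and> 1 \<le> period_count D u v"
  proof cases
    case 1
    have "1 \<le> D / (2 * u)" using 1 assms by (simp add: field_simps)
    moreover have "0 \<le> D / (2 * v)" using 1 assms by simp
    ultimately have "1 \<le> period_count D u v" unfolding period_count_def by linarith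
    moreover have "0 < u" "u \<le> v" using 1 assms by auto
    ultimately show ?thesis using 1(2,5) assms(1,2) by auto
  next
    case 2
    then have "0 < u" using assms by (auto simp: min_def)
    then show ?thesis using 2 by (auto simp: period_count_def)
  qed
  then show "0 < D" "0 < u" "u \<le> v" "0 \<le> s" "s < 1" "1 \<le> period_count D u v" by auto
qed

lemma valid_plan_policy: "0 < x \<Longrightarrow> 0 < y \<Longrightarrow> valid_policy (plan_policy (plan x y late))"
proof -
  assume xy: "0 < x" "0 < y"
  obtain D u v s where P: "plan x y late = (D, u, v, s)" by (metis prod_cases4)
  show ?thesis
    using valid_schedule[OF plan_valid(1-5)[OF xy P]] by (simp add: P plan_policy_def)
qed

lemma plan_policy_cost:
  assumes x: "0 < x" and y: "0 < y" and "compatible x y \<or> x = y" and K: "0 \<le> K" and h: "0 \<le> h"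
  shows "long_run_cost K h (plan_policy (plan x y late)) \<le> ereal (21/20 * (K / x + h * x))"
proof -
  obtain D u v s where P: "plan x y late = (D, u, v, s)" by (metis prod_cases4)
  note valid = plan_valid[OF x y P]
  have "(1 / u + 1 / v) / 2 \<le> 21/20 * (1 / x) \<and> (u + v) / 2 \<le> 21/20 * x"
  proof -
    consider "u = 7/9 * x" "v = 5/4 * x" | "u = x" "v = x"
      | "u = min x y" "v = u" "x \<le> 21/20 * y"
    proof -
      have "x = y \<or> 28 * x < y \<or> 28 * y < x \<or> x < 21/20 * y"
        using assms(3) unfolding compatible_def by blast
      moreover have "x = y \<Longrightarrow> x \<le> 21/20 * y" using x by simp
      ultimately show thesis
        using P that unfolding plan_def by (smt (verit) Pair_inject)
    qed
    then show ?thesis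
    proof cases
      case 1
      \<comment> \<open>Here the ordering factor is 73/70 and the holding factor 73/72.\<close>
      show ?thesis unfolding 1 using x by (simp add: field_simps)
    next
      case 2
      then show ?thesis using x by (simp add: field_simps)
    next
      case 3
      \<comment> \<open>Shortening an interval raises only the ordering cost, by the ratio of the
        intervals.\<close>
      have "x \<le> 21/20 * u" "u \<le> x" using 3 x by (auto simp: min_def)
      then have "1 / u \<le> 21/20 * (1 / x)" using valid(2) x by (simp add: field_simps)
      then show ?thesis using 3(2) \<open>u \<le> x\<close> x by simp
    qed
  qed
  then have "K * ((1 / u + 1 / v) / 2) \<le> K * (21/20 * (1 / x))" "h * ((u + v) / 2) \<le> h * (21/20 * x)"
    by (blast intro: mult_left_mono K h)+
  then have "K * ((1 / u + 1 / v) / 2) + h * ((u + v) / 2) \<le> K * (21/20 * (1 / x)) + h * (21/20 * x)"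
    by (rule add_mono)
  also have "\<dots> = 21/20 * (K / x + h * x)"
    by (simp add: algebra_simps)
  finally have "K * ((1 / u + 1 / v) / 2) + h * ((u + v) / 2) \<le> 21/20 * (K / x + h * x)" .
  moreover have "long_run_cost K h (plan_policy (plan x y late)) \<le>
      ereal (K * ((1 / u + 1 / v) / 2) + h * ((u + v) / 2))"
    using long_run_cost_schedule_le[OF valid(1-5) K h] by (simp add: P plan_policy_def)
  ultimately show ?thesis by (meson ereal_less_eq(3) order_trans)
qed

section \<open>Weighted peaks of coordinated commodities\<close>

lemma plan_policy_unpaired_peak:
  assumes "0 < x" "0 \<le> t"
  shows "inventory (plan_policy (plan x x False)) t \<le> x"
  using inventory_schedule_le[of x x x 0 t] assms by (simp add: plan_def plan_policy_def)

text \<open>Relative to its own interval, each inventory has weight \<open>a * x\<close> or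
  \<open>c * y\<close>, both at most \<open>W\<close>. This reduces the claim to the unweighted sum
  of relative inventories.\<close>

lemma far_plan_peak:
  assumes x: "0 < x" and far: "28 * x < y" and a: "0 \<le> a" "a * x \<le> W" and c: "0 \<le> c" "c * y \<le> W"
    and t: "0 \<le> t"
  shows "a * inventory (plan_policy (plan x y l)) t + c * inventory (plan_policy (plan y x l')) t
    \<le> 16/9 * W"
proof -
  have y: "0 < y" using x far by simp
  let ?I = "inventory (plan_policy (plan x y l)) t" and ?J = "inventory (plan_policy (plan y x l')) t"
  have P: "plan x y l = (y, 7/9 * x, 5/4 * x, 0)" "plan y x l' = (y, y, y, 0)"
    using x far by (auto simp: plan_def)
  have nonneg: "0 \<le> ?I" "0 \<le> ?J"
    using valid_plan_policy[OF x y, of l] valid_plan_policy[OF y x, of l'] t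
    by (auto simp: valid_policy_def)
  have W: "0 \<le> W" using a x by (meson mult_nonneg_nonneg less_imp_le order_trans)
  have "a * ?I = (a * x) * (?I / x)" using x by simp
  also have "\<dots> \<le> W * (?I / x)" using a nonneg x by (intro mult_right_mono) auto
  finally have 1: "a * ?I \<le> W * (?I / x)" .
  have "c * ?J = (c * y) * (?J / y)" using y by simp
  also have "\<dots> \<le> W * (?J / y)" using c nonneg y by (intro mult_right_mono) auto
  finally have 2: "c * ?J \<le> W * (?J / y)" .
  have "W * (?I / x + ?J / y) \<le> W * (16/9)"
    using far_pair_peak[OF x far t] W unfolding P plan_policy_def
    by (intro mult_left_mono) auto
  then show ?thesis using 1 2 by (simp add: distrib_left mult.commute)
qed

lemma near_plan_peak:
  assumes x: "0 < x" and y: "0 < y" and near: "\<not> 28 * x < y" "\<not> 28 * y < x"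
    and a: "0 \<le> a" "a * x \<le> W" and c: "0 \<le> c" "c * y \<le> W" and t: "0 \<le> t"
  shows "a * inventory (plan_policy (plan x y False)) t + c * inventory (plan_policy (plan y x True)) t
    \<le> 16/9 * W"
proof -
  let ?I = "inventory (plan_policy (plan x y False)) t"
    and ?J = "inventory (plan_policy (plan y x True)) t"
  define m where "m = min x y"
  have m: "0 < m" "m \<le> x" "m \<le> y" using x y by (auto simp: m_def)
  have P: "plan x y False = (m, m, m, 0)" "plan y x True = (m, m, m, 1/2)"
    using near by (auto simp: plan_def m_def min.commute)
  have nonneg: "0 \<le> ?I" "0 \<le> ?J"
    using valid_plan_policy[OF x y, of False] valid_plan_policy[OF y x, of True] t
    by (auto simp: valid_policy_def)
  have W: "0 \<le> W" using a x by (meson mult_nonneg_nonneg less_imp_le order_trans)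
  have am: "a * m \<le> W" "c * m \<le> W"
    using a c m by (meson mult_left_mono order_trans)+
  have "a * ?I = (a * m) * (?I / m)" using m by simp
  also have "\<dots> \<le> W * (?I / m)" using am nonneg m by (intro mult_right_mono) auto
  finally have 1: "a * ?I \<le> W * (?I / m)" .
  have "c * ?J = (c * m) * (?J / m)" using m by simp
  also have "\<dots> \<le> W * (?J / m)" using am nonneg m by (intro mult_right_mono) auto
  finally have 2: "c * ?J \<le> W * (?J / m)" .
  have "?I + ?J \<le> 3/2 * m"
    using near_pair_peak[OF m(1) t] unfolding P plan_policy_def by simp
  then have "?I / m + ?J / m \<le> 3/2" using m by (simp add: field_simps)
  then have "W * (?I / m + ?J / m) \<le> W * (16/9)"
    using W by (intro mult_left_mono) auto
  then show ?thesis using 1 2 by (simp add: distrib_left mult.commute)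
qed

lemma paired_plan_peak:
  assumes "0 < x" "0 < y" "0 \<le> a" "a * x \<le> W" "0 \<le> c" "c * y \<le> W" "0 \<le> t"
  shows "a * inventory (plan_policy (plan x y l)) t + c * inventory (plan_policy (plan y x (\<not> l))) t
    \<le> 16/9 * W"
proof -
  consider "28 * x < y" | "28 * y < x" | "\<not> 28 * x < y" "\<not> 28 * y < x" by blast
  then show ?thesis
  proof cases
    case 1
    then show ?thesis using assms by (intro far_plan_peak) auto
  next
    case 2
    then show ?thesis using far_plan_peak[of y x c W a t "\<not> l" l] assms by simp
  next
    case 3
    then show ?thesis
      using near_plan_peak[of x y a W c t] near_plan_peak[of y x c W a t] assms by (cases l) auto
  qed
qed

text \<open>Since the pairing is an involution, summing \<open>f i + f (\<sigma> i)\<close> over all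
  \<open>i\<close> counts everything twice.\<close>

lemma total_peak:
  fixes n :: nat and \<gamma> T :: "nat \<Rightarrow> real"
  assumes T: "\<And>i. i < n \<Longrightarrow> 0 < T i" and \<gamma>: "\<And>i. i < n \<Longrightarrow> 0 \<le> \<gamma> i"
    and W: "\<And>i. i < n \<Longrightarrow> \<gamma> i * T i \<le> W" "0 \<le> W" and t: "0 \<le> t"
  shows "(\<Sum>i<n. \<gamma> i * inventory (commodity_policy T n i) t) \<le> (8/9 * real n + 101/9) * W"
proof -
  define \<sigma> where "\<sigma> = partner T n"
  define f where "f i = \<gamma> i * inventory (commodity_policy T n i) t" for i
  have \<sigma>: "\<sigma> i < n" "\<sigma> (\<sigma> i) = i" if "i < n" for i
    using pairing_partner[of T n] that by (auto simp: pairing_def \<sigma>_def)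
  \<comment> \<open>A fixed point is counted as a pair with itself and reaches \<open>2 * W\<close>,
    an excess of \<open>2/9 * W\<close> over a true pair.\<close>
  have bound: "f i + f (\<sigma> i) \<le> 16/9 * W + (if \<sigma> i = i then 2/9 * W else 0)" if i: "i < n" for i
  proof (cases "\<sigma> i = i")
    case True
    have "f i \<le> \<gamma> i * T i"
      using plan_policy_unpaired_peak[OF T[OF i] t] \<gamma>[OF i] True
      by (auto simp: f_def commodity_policy_def \<sigma>_def intro!: mult_left_mono)
    then show ?thesis using W(1)[OF i] True by simp
  next
    case False
    have "(\<sigma> (\<sigma> i) < \<sigma> i) = (\<not> \<sigma> i < i)" using False \<sigma>[OF i] by auto
    then have "f i + f (\<sigma> i) \<le> 16/9 * W"
      using paired_plan_peak[of "T i" "T (\<sigma> i)" "\<gamma> i" W "\<gamma> (\<sigma> i)" t "\<sigma> i < i"]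
        T[OF i] T[OF \<sigma>(1)[OF i]] \<gamma>[OF i] \<gamma>[OF \<sigma>(1)[OF i]] W(1)[OF i] W(1)[OF \<sigma>(1)[OF i]] t \<sigma>[OF i]
      by (simp add: f_def commodity_policy_def flip: \<sigma>_def)
    then show ?thesis using False by simp
  qed
  have "(\<Sum>i<n. f (\<sigma> i)) = (\<Sum>i<n. f i)"
    by (rule sum.reindex_bij_witness[of _ \<sigma> \<sigma>]) (use \<sigma> in auto)
  then have "2 * (\<Sum>i<n. f i) = (\<Sum>i<n. f i + f (\<sigma> i))" by (simp add: sum.distrib)
  also have "\<dots> \<le> (\<Sum>i<n. 16/9 * W + (if \<sigma> i = i then 2/9 * W else 0))"
    by (intro sum_mono bound) auto
  also have "\<dots> = real n * (16/9 * W) + real (card {i. i < n \<and> \<sigma> i = i}) * (2/9 * W)"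
    by (simp add: sum.distrib flip: sum.inter_filter)
  also have "\<dots> \<le> real n * (16/9 * W) + 101 * (2/9 * W)"
    using card_unpaired_le[of n T, OF T] W(2)
    by (intro add_left_mono mult_right_mono) (auto simp: \<sigma>_def)
  finally show ?thesis by (simp add: f_def algebra_simps)
qed


section \<open>The program for the policy\<close>

text \<open>Register 6 holds 1, so \<open>Mul r 6 x\<close> copies a register. The partner index is
  \<open>i\<close> plus the stored offset; comparing it with \<open>i\<close> yields the flag
  \<open>late\<close>.\<close>

definition plan_prog :: prog where
  "plan_prog =
     Seq (block [Add 15 7 4, Load 16 15, Add 17 4 16,
                 Mul 20 11 4, Add 20 20 12, Load 21 20,
                 Mul 20 11 17, Add 20 20 12, Load 22 20, Mul 23 13 21, Mul 24 13 22])
    (Seq (IfLess 23 22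
            (block [Const 20 (7/9), Mul 31 20 21, Const 20 (5/4), Mul 32 20 21,
                    Mul 30 6 22, Const 33 0])
            (IfLess 24 21
               (block [Mul 30 6 21, Mul 31 6 21, Mul 32 6 21, Const 33 0])
               (Seq (IfLess 22 21 (block [Mul 30 6 22]) (block [Mul 30 6 21]))
               (Seq (block [Mul 31 6 30, Mul 32 6 30])
                    (IfLess 17 4 (block [Const 33 (1/2)]) (block [Const 33 0]))))))
         (block [Add 34 31 31, Divide 34 30 34, Add 35 32 32, Divide 35 30 35, Add 35 34 35,
                 Sub 36 32 31, Const 37 (1/2), Const 38 0]))"

definition policy_prog :: prog where
  "policy_prog =
     Seq partner_prog
    (Seq plan_prog
    (Seq order_time_prog
    (Seq (block [Mul 0 6 40, Add 5 5 6])
    (Seq order_time_prog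
         (block [Sub 1 40 0])))))"

lemma runs_plan:
  assumes st: "pairing_state T n i k \<sigma> st" and i: "i < n" "\<sigma> i < n"
    and P: "plan (T i) (T (\<sigma> i)) (\<sigma> i < i) = (D, u, v, s)" and uv: "0 < u" "0 < v"
  shows "runs \<omega> plan_prog st 27 (schedule_state D u v s k)"
  unfolding plan_prog_def
proof -
  let ?x = "T i" and ?y = "T (\<sigma> i)"
  let ?B = "\<lambda>a. regs a 4 = real i \<and> regs a 5 = real k \<and> regs a 6 = 1 \<and> regs a 17 = real (\<sigma> i) \<and>
    regs a 21 = ?x \<and> regs a 22 = ?y \<and> regs a 23 = 28 * ?x \<and> regs a 24 = 28 * ?y"
  let ?C = "\<lambda>a. regs a 5 = real k \<and> regs a 6 = 1 \<and> regs a 30 = D \<and> regs a 31 = u \<and> regs a 32 = v \<and>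
    regs a 33 = s"
  have 1: "runs \<omega> (block [Add 15 7 4, Load 16 15, Add 17 4 16,
                 Mul 20 11 4, Add 20 20 12, Load 21 20,
                 Mul 20 11 17, Add 20 20 12, Load 22 20, Mul 23 13 21, Mul 24 13 22]) st 11 ?B"
    apply (rule runs_block)
    using st i
       apply (simp add: pairing_state_def set_reg_def address_simps)
    using st i apply (auto simp: pairing_state_def address_simps)
    done
  have 2: "runs \<omega> (IfLess 23 22
            (block [Const 20 (7/9), Mul 31 20 21, Const 20 (5/4), Mul 32 20 21,
                    Mul 30 6 22, Const 33 0])
            (IfLess 24 21
               (block [Mul 30 6 21, Mul 31 6 21, Mul 32 6 21, Const 33 0])
               (Seq (IfLess 22 21 (block [Mul 30 6 22]) (block [Mul 30 6 21]))
               (Seq (block [Mul 31 6 30, Mul 32 6 30])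
                    (IfLess 17 4 (block [Const 33 (1/2)]) (block [Const 33 0])))))) a (Suc (Suc 6)) ?C"
    if a: "?B a" for a
  proof (intro runs_IfLess)
    assume "regs a 23 < regs a 22"
    then have "(D, u, v, s) = (?y, 7/9 * ?x, 5/4 * ?x, 0)" using a P by (simp add: plan_def)
    then show "runs \<omega> (block [Const 20 (7/9), Mul 31 20 21, Const 20 (5/4), Mul 32 20 21,
        Mul 30 6 22, Const 33 0]) a (Suc 6) ?C"
      using a by (intro runs_block) (auto simp: set_reg_def of_rat_divide)
  next
    assume "\<not> regs a 23 < regs a 22" "regs a 24 < regs a 21"
    then have "(D, u, v, s) = (?x, ?x, ?x, 0)" using a P by (simp add: plan_def)
    then show "runs \<omega> (block [Mul 30 6 21, Mul 31 6 21, Mul 32 6 21, Const 33 0]) a 6 ?C"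
      using a by (intro runs_block) (auto simp: set_reg_def)
  next
    assume near: "\<not> regs a 23 < regs a 22" "\<not> regs a 24 < regs a 21"
    let ?m = "min ?x ?y"
    have eq: "(D, u, v, s) = (?m, ?m, ?m, if \<sigma> i < i then 1/2 else 0)"
      using near a P by (simp add: plan_def)
    let ?E = "\<lambda>b. regs b 4 = real i \<and> regs b 5 = real k \<and> regs b 6 = 1 \<and> regs b 17 = real (\<sigma> i) \<and>
      regs b 30 = ?m"
    have 1: "runs \<omega> (IfLess 22 21 (block [Mul 30 6 22]) (block [Mul 30 6 21])) a (Suc 1) ?E"
      using a by (intro runs_IfLess runs_block) (auto simp: set_reg_def)
    have 2: "runs \<omega> (block [Mul 31 6 30, Mul 32 6 30]) b 2
        (\<lambda>b. ?E b \<and> regs b 31 = ?m \<and> regs b 32 = ?m)" if "?E b" for b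
      using that by (intro runs_block) (auto simp: set_reg_def)
    have 3: "runs \<omega> (IfLess 17 4 (block [Const 33 (1/2)]) (block [Const 33 0])) b (Suc 1) ?C"
      if "?E b \<and> regs b 31 = ?m \<and> regs b 32 = ?m" for b
      using that eq by (intro runs_IfLess runs_block) (auto simp: set_reg_def of_rat_divide)
    show "runs \<omega> (Seq (IfLess 22 21 (block [Mul 30 6 22]) (block [Mul 30 6 21]))
               (Seq (block [Mul 31 6 30, Mul 32 6 30])
                    (IfLess 17 4 (block [Const 33 (1/2)]) (block [Const 33 0])))) a 6 ?C"
      by (rule runs_Seq[OF 1], rule runs_Seq[OF 2], assumption, erule 3) auto
  qed
  have 3: "runs \<omega> (block [Add 34 31 31, Divide 34 30 34, Add 35 32 32, Divide 35 30 35, Add 35 34 35,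
      Sub 36 32 31, Const 37 (1/2), Const 38 0]) a 8 (schedule_state D u v s k)" if a: "?C a" for a
    apply (rule runs_block)
    using a uv
       apply (simp add: set_reg_def)
    using a uv apply (auto simp: schedule_state_def small_count_def period_count_def of_rat_divide)
    done
  show "runs \<omega> (Seq (block [Add 15 7 4, Load 16 15, Add 17 4 16,
                 Mul 20 11 4, Add 20 20 12, Load 21 20,
                 Mul 20 11 17, Add 20 20 12, Load 22 20, Mul 23 13 21, Mul 24 13 22])
    (Seq (IfLess 23 22
            (block [Const 20 (7/9), Mul 31 20 21, Const 20 (5/4), Mul 32 20 21,
                    Mul 30 6 22, Const 33 0])
            (IfLess 24 21
               (block [Mul 30 6 21, Mul 31 6 21, Mul 32 6 21, Const 33 0])
               (Seq (IfLess 22 21 (block [Mul 30 6 22]) (block [Mul 30 6 21]))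
               (Seq (block [Mul 31 6 30, Mul 32 6 30])
                    (IfLess 17 4 (block [Const 33 (1/2)]) (block [Const 33 0]))))))
         (block [Add 34 31 31, Divide 34 30 34, Add 35 32 32, Divide 35 30 35, Add 35 34 35,
                 Sub 36 32 31, Const 37 (1/2), Const 38 0]))) st 27 (schedule_state D u v s k)"
    by (rule runs_Seq[OF 1], rule runs_Seq[OF 2], assumption, erule 3) auto
qed

text \<open>The constant is \<open>7 + 27 + 20 + 2 + 20 + 1\<close>. The bound on
  \<open>Suc k\<close> serves both order-time runs, because the quantity is the distance to the next
  order time.\<close>

lemma runs_policy:
  assumes st: "regs st 0 = real n" "regs st 4 = real i" "regs st 5 = real k" "regs st 8 = 0"
    "\<And>j. j < n \<Longrightarrow> heap st (4 * j + 3) = T j" "\<And>j. j < n \<Longrightarrow> heap st (4 * n + j) = 0"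
    and i: "i < n" and T: "\<And>j. j < n \<Longrightarrow> 0 < T j" and J: "real (Suc k) \<le> 2 ^ J"
  shows "runs \<omega> policy_prog st (77 + n * (28 * n + 4) + 14 * J)
    (\<lambda>st'. regs st' 0 = order_time (commodity_policy T n i) k \<and>
           regs st' 1 = order_qty (commodity_policy T n i) k)"
  unfolding policy_prog_def
proof -
  let ?j = "partner T n i"
  have j: "?j < n" using pairing_partner[of T n] i by (simp add: pairing_def)
  obtain D u v s where P: "plan (T i) (T ?j) (?j < i) = (D, u, v, s)" by (metis prod_cases4)
  note valid = plan_valid[OF T[OF i] T[OF j] P]
  have v: "0 < v" using valid by simp
  have pol: "commodity_policy T n i = zero_inventory (schedule D u v s)"
    by (simp add: commodity_policy_def P plan_policy_def)
  have k: "real k \<le> 2 ^ J" using J unfolding of_nat_Suc by linarith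
  let ?S = "schedule D u v s"
  have 1: "runs \<omega> partner_prog st (7 + n * (28 * n + 4)) (pairing_state T n i k (partner T n))"
    by (rule runs_partner) (use st in auto)
  have 2: "runs \<omega> plan_prog a 27 (schedule_state D u v s k)"
    if "pairing_state T n i k (partner T n) a" for a
    by (rule runs_plan[OF that i j P valid(2) v])
  have 3: "runs \<omega> order_time_prog a (20 + 7 * J)
      (\<lambda>b. schedule_state D u v s k b \<and> regs b 40 = ?S k)" if "schedule_state D u v s k a" for a
    by (rule runs_mono[OF runs_order_time[OF that valid(1-4,6) k]])
       (use that agree_regs in \<open>auto simp: schedule_state_def\<close>)
  have 4: "runs \<omega> (block [Mul 0 6 40, Add 5 5 6]) a 2
      (\<lambda>b. schedule_state D u v s (Suc k) b \<and> regs b 0 = ?S k)"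
    if "schedule_state D u v s k a \<and> regs a 40 = ?S k" for a
    using that by (intro runs_block) (auto simp: schedule_state_def set_reg_def)
  have 5: "runs \<omega> order_time_prog a (20 + 7 * J) (\<lambda>b. regs b 40 = ?S (Suc k) \<and> regs b 0 = ?S k)"
    if "schedule_state D u v s (Suc k) a \<and> regs a 0 = ?S k" for a
    by (rule runs_mono[OF runs_order_time[OF conjunct1[OF that] valid(1-4,6) J]])
       (use that agree_regs in auto)
  have 6: "runs \<omega> (block [Sub 1 40 0]) a 1
    (\<lambda>st'. regs st' 0 = order_time (commodity_policy T n i) k \<and>
           regs st' 1 = order_qty (commodity_policy T n i) k)"
    if "regs a 40 = ?S (Suc k) \<and> regs a 0 = ?S k" for a
    using that by (intro runs_block) (auto simp: set_reg_def pol zero_inventory_def)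
  show "runs \<omega> (Seq partner_prog (Seq plan_prog (Seq order_time_prog
    (Seq (block [Mul 0 6 40, Add 5 5 6]) (Seq order_time_prog (block [Sub 1 40 0])))))) st
    (77 + n * (28 * n + 4) + 14 * J)
    (\<lambda>st'. regs st' 0 = order_time (commodity_policy T n i) k \<and>
           regs st' 1 = order_qty (commodity_policy T n i) k)"
    by (rule runs_Seq[OF 1], rule runs_Seq[OF 2], assumption,
        rule runs_Seq[OF 3], assumption, rule runs_Seq[OF 4], assumption,
        rule runs_Seq[OF 5], assumption, erule 6) auto
qed


section \<open>Polynomial running time on the query encoding\<close>

lemma query_state_simps:
  "regs (query_state I i k) 0 = real (num I)" "regs (query_state I i k) 4 = real i"
  "regs (query_state I i k) 5 = real k" "regs (query_state I i k) 8 = 0"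
  by (simp_all add: query_state_def)

lemma query_state_heap:
  "j < num I \<Longrightarrow> heap (query_state I i k) (4 * j + 3) = That I j"
  "heap (query_state I i k) (4 * num I + j) = 0"
proof -
  have "(4 * j + 3) div 4 = j" "(4 * j + 3) mod 4 = 3" by presburger+
  then show "j < num I \<Longrightarrow> heap (query_state I i k) (4 * j + 3) = That I j"
    by (simp add: query_state_def Let_def)
  have "\<not> (4 * num I + j) div 4 < num I" by presburger
  then show "heap (query_state I i k) (4 * num I + j) = 0"
    by (simp only: query_state_def Let_def state.simps if_False)
qed

lemma constructs_commodity_policy:
  assumes "1 \<le> lev I" and T: "\<And>i. i < num I \<Longrightarrow> 0 < That I i"
  shows "constructs_within policy_prog 300 2 I (\<lambda>\<omega> i. commodity_policy (That I) (num I) i)"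
  unfolding constructs_within_def
proof (intro ballI allI impI)
  fix \<omega> i k assume i: "i < num I"
  define n where "n = num I"
  define L where "L = log 2 (real (k + 1))"
  define J where "J = nat \<lceil>L\<rceil>"
  have L: "0 \<le> L" by (simp add: L_def)
  have "real (Suc k) = 2 powr L" by (simp add: L_def)
  also have "\<dots> \<le> 2 powr real J" by (intro powr_mono) (auto simp: J_def real_nat_ceiling_ge)
  finally have J: "real (Suc k) \<le> 2 ^ J" by (simp add: powr_realpow)
  have JL: "real J \<le> L + 1" using L unfolding J_def by linarith
  let ?st = "query_state I i k"
  have "runs \<omega> policy_prog ?st (77 + n * (28 * n + 4) + 14 * J)
    (\<lambda>st'. regs st' 0 = order_time (commodity_policy (That I) n i) k \<and>
           regs st' 1 = order_qty (commodity_policy (That I) n i) k)"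
    unfolding n_def
    by (rule runs_policy[OF query_state_simps query_state_heap i T J])
  then obtain m st' where run: "exec \<omega> policy_prog ?st m st'" "m \<le> 77 + n * (28 * n + 4) + 14 * J"
    "regs st' 0 = order_time (commodity_policy (That I) n i) k"
    "regs st' 1 = order_qty (commodity_policy (That I) n i) k"
    by (auto simp: runs_def)
  \<comment> \<open>All summands of the query size are nonnegative, so it is at least
    \<open>n + L\<close>, and a quadratic bound in \<open>n + L\<close> suffices.\<close>
  have "0 \<le> log 2 (real (lev I))" using assms(1) by simp
  moreover have "0 \<le> (\<Sum>j<num I. \<bar>log 2 (K\<^sub>c I j)\<bar> + \<bar>log 2 (H\<^sub>c I j)\<bar> + \<bar>log 2 (gam I j)\<bar> + \<bar>log 2 (That I j)\<bar>)"
    by (intro sum_nonneg) auto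
  ultimately have "real n + L \<le> query_size I k"
    unfolding query_size_def n_def L_def by linarith
  then have "(1 + (real n + L))\<^sup>2 \<le> (1 + query_size I k)\<^sup>2"
    using L by (intro power_mono) auto
  moreover have "real m \<le> 300 * (1 + (real n + L))\<^sup>2"
  proof -
    have "real m \<le> real (77 + n * (28 * n + 4) + 14 * J)" using run(2) by (rule of_nat_mono)
    also have "\<dots> = 77 + 28 * (real n * real n) + 4 * real n + 14 * real J"
      by (simp add: algebra_simps)
    also have "\<dots> \<le> 300 * (1 + real n * real n + real n + L)"
    proof -
      have "0 \<le> real n * real n" "0 \<le> real n" by simp_all
      then show ?thesis using JL L unfolding distrib_left by linarith
    qed
    also have "\<dots> \<le> 300 * (1 + (real n + L))\<^sup>2"
    proof -
      have "(1 + (real n + L))\<^sup>2 = 1 + real n * real n + real n + L + (L * L + L + real n + 2 * (real n * L))"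
        by (simp add: power2_eq_square algebra_simps)
      moreover have "0 \<le> L * L + L + real n + 2 * (real n * L)" using L by simp
      ultimately show ?thesis by (intro mult_left_mono) linarith+
    qed
    finally show ?thesis .
  qed
  ultimately have "real m \<le> 300 * (1 + query_size I k)\<^sup>2" by linarith
  then show "\<exists>m st'. exec \<omega> policy_prog ?st m st' \<and>
      regs st' 0 = order_time (commodity_policy (That I) (num I) i) k \<and>
      regs st' 1 = order_qty (commodity_policy (That I) (num I) i) k \<and>
      real m \<le> 300 * (1 + query_size I k) ^ 2"
    using run unfolding n_def by blast
qed

section \<open>Joint cost and final numerical estimates\<close>

lemma joint_cost_commodity_policy_le:
  assumes pos: "\<And>i. i < num I \<Longrightarrow> 0 < K\<^sub>c I i \<and> 0 < H\<^sub>c I i \<and> 0 < That I i"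
  shows "joint_cost I (commodity_policy (That I) (num I)) \<le>
    ereal (21/20 * (\<Sum>i<num I. K\<^sub>c I i / That I i + H\<^sub>c I i * That I i))"
proof -
  let ?T = "That I" and ?n = "num I"
  have "joint_cost I (commodity_policy ?T ?n)
      \<le> (\<Sum>i<?n. ereal (21/20 * (K\<^sub>c I i / ?T i + H\<^sub>c I i * ?T i)))"
    unfolding joint_cost_def commodity_policy_def
  proof (intro sum_mono plan_policy_cost)
    fix i assume "i \<in> {..<?n}"
    then have i: "i < ?n" by simp
    then have p: "partner ?T ?n i < ?n"
      "partner ?T ?n i \<noteq> i \<longrightarrow> compatible (?T i) (?T (partner ?T ?n i))"
      using pairing_partner[of ?T ?n] by (auto simp: pairing_def)
    show "0 < ?T i" "0 < ?T (partner ?T ?n i)" "0 \<le> K\<^sub>c I i" "0 \<le> H\<^sub>c I i"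
      using pos[OF i] pos[OF p(1)] by auto
    show "compatible (?T i) (?T (partner ?T ?n i)) \<or> ?T i = ?T (partner ?T ?n i)"
      using p(2) by metis
  qed
  also have "\<dots> = ereal (21/20 * (\<Sum>i<?n. K\<^sub>c I i / ?T i + H\<^sub>c I i * ?T i))"
    by (simp add: sum_ereal sum_distrib_left)
  finally show ?thesis .
qed

text \<open>The bound 0.983 must be this sharp: \<open>(32/31) / 0.983\<close> barely exceeds 21/20,
  and \<open>(7/4) / 0.983\<close> barely exceeds 1.78, itself just above 16/9.\<close>

lemma sqrt2_ln2_bounds: "0 < sqrt 2 * ln (2::real)" "sqrt 2 * ln (2::real) \<le> 983 / 1000"
proof -
  show "0 < sqrt 2 * ln (2::real)" by simp
  have "sqrt 2 \<le> (1415 / 1000 :: real)" by (rule real_le_lsqrt) (auto simp: power2_eq_square)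
  then have "sqrt 2 * ln 2 \<le> 1415 / 1000 * (25 / 36 :: real)"
    using ln2_le_25_over_36 by (intro mult_mono) auto
  then show "sqrt 2 * ln (2::real) \<le> 983 / 1000" by simp
qed

theorem theorem2:
  shows "\<exists>(p :: prog) (c :: real) (d :: nat). \<forall>I :: problem.
    0 < eps I \<and> eps I < 1 / 10 \<and> 0 < cap I \<and> 1 \<le> lev I \<and>
    real (num I) \<ge> 100 * ln (1 / eps I) / eps I ^ 4 \<and>
    (\<forall>i<num I. 0 < K\<^sub>c I i \<and> 0 < H\<^sub>c I i \<and> 0 < gam I i \<and> 0 < That I i \<and>
       gam I i * That I i / 2 \<le> level_cap I) \<and>
    real (card (heavy I)) > real (num I) / 2
    \<longrightarrow>
    (\<exists>\<P>. random_policy I \<P> \<and> constructs_within p c d I \<P> \<and>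
      (AE \<omega> in seeds. V_max I (\<P> \<omega>) \<le>
         ereal ((1 + 6 * eps I) * ((7 / 4) / (sqrt 2 * ln 2)) * real (num I) * level_cap I)) \<and>
      expected_cost I \<P> \<le>
         ennreal ((1 + 2 * eps I / 5) * ((32 / 31) / (sqrt 2 * ln 2)) *
           (\<Sum>i<num I. K\<^sub>c I i / That I i + H\<^sub>c I i * That I i)))"
proof (rule exI[of _ policy_prog], rule exI[of _ 300], rule exI[of _ 2], intro allI impI)
  fix I :: problem
  assume I: "0 < eps I \<and> eps I < 1 / 10 \<and> 0 < cap I \<and> 1 \<le> lev I \<and>
    real (num I) \<ge> 100 * ln (1 / eps I) / eps I ^ 4 \<and>
    (\<forall>i<num I. 0 < K\<^sub>c I i \<and> 0 < H\<^sub>c I i \<and> 0 < gam I i \<and> 0 < That I i \<and>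
       gam I i * That I i / 2 \<le> level_cap I) \<and>
    real (card (heavy I)) > real (num I) / 2"
  define P where "P = commodity_policy (That I) (num I)"
  have eps: "0 < eps I" "eps I < 1 / 10" and lev: "1 \<le> lev I" using I by auto
  have pos: "0 < K\<^sub>c I i" "0 < H\<^sub>c I i" "0 < gam I i" "0 < That I i"
    "gam I i * That I i \<le> 2 * level_cap I" if "i < num I" for i
    using I that by auto
  have M: "0 \<le> level_cap I" using I by (auto simp: level_cap_def)
  \<comment> \<open>From \<open>eps I < 1/10\<close> and \<open>exp 1 \<le> 3\<close> follow
    \<open>ln (1 / eps I) \<ge> 1\<close> and \<open>1 / eps I ^ 4 \<ge> 10 ^ 4\<close>.\<close>
  have n: "1000000 \<le> real (num I)"
  proof -
    have "eps I * exp 1 \<le> 1 / 10 * 3" using exp_le eps by (intro mult_mono) auto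
    then have "exp 1 \<le> 1 / eps I" using eps by (simp add: field_simps)
    then have "1 \<le> ln (1 / eps I)" using eps by (simp add: ln_ge_iff)
    moreover have "eps I ^ 4 \<le> (1 / 10) ^ 4" using eps by (intro power_mono) auto
    ultimately have "100 * 1 / (1 / 10) ^ 4 \<le> 100 * ln (1 / eps I) / eps I ^ 4"
      using eps by (intro frac_le) auto
    also have "\<dots> \<le> real (num I)" using I by blast
    finally show ?thesis by (simp add: power_divide)
  qed
  have prob: "prob_space seeds" by (rule prob_space_seeds)

  have valid: "valid_policy (P i)" if "i < num I" for i
    using pairing_partner[of "That I" "num I"] that pos
    by (auto simp: P_def commodity_policy_def pairing_def intro!: valid_plan_policy)
  have "random_policy I (\<lambda>_. P)"
    using valid by (simp add: random_policy_def)
  moreover have "constructs_within policy_prog 300 2 I (\<lambda>_. P)"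
    using constructs_commodity_policy[OF lev pos(4)] by (simp add: P_def)
  moreover have "V_max I P \<le>
      ereal ((1 + 6 * eps I) * ((7 / 4) / (sqrt 2 * ln 2)) * real (num I) * level_cap I)"
    unfolding V_max_def
  proof (intro SUP_least)
    fix t :: real assume "t \<in> {0..}"
    then have "(\<Sum>i<num I. gam I i * inventory (P i) t) \<le> (8/9 * real (num I) + 101/9) * (2 * level_cap I)"
      unfolding P_def using pos M by (intro total_peak) (auto intro: less_imp_le)
    also have "\<dots> = (16/9 * real (num I) + 202/9) * level_cap I" by (simp add: algebra_simps)
    \<comment> \<open>The gap between 1.78 and 16/9 is 1/450; with a million commodities it exceeds
      the contribution 202/9 of the unpaired ones.\<close>
    also have "\<dots> \<le> (1 * (178/100) * real (num I)) * level_cap I"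
      using n M by (intro mult_right_mono) auto
    also have "\<dots> \<le> ((1 + 6 * eps I) * ((7 / 4) / (sqrt 2 * ln 2)) * real (num I)) * level_cap I"
      using eps M sqrt2_ln2_bounds by (intro mult_right_mono mult_mono) (auto simp: field_simps)
    finally show "ereal (\<Sum>i<num I. gam I i * inventory (P i) t) \<le>
      ereal ((1 + 6 * eps I) * ((7 / 4) / (sqrt 2 * ln 2)) * real (num I) * level_cap I)"
      by simp
  qed
  moreover have "expected_cost I (\<lambda>_. P) \<le> ennreal ((1 + 2 * eps I / 5) * ((32 / 31) / (sqrt 2 * ln 2)) *
           (\<Sum>i<num I. K\<^sub>c I i / That I i + H\<^sub>c I i * That I i))"
  proof -
    let ?S = "\<Sum>i<num I. K\<^sub>c I i / That I i + H\<^sub>c I i * That I i"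
    have S: "0 \<le> ?S" using pos(1,2,4)
      by (intro sum_nonneg add_nonneg_nonneg divide_nonneg_nonneg mult_nonneg_nonneg)
         (auto intro: less_imp_le)
    \<comment> \<open>The integrand is constant and \<open>seeds\<close> has total mass 1.\<close>
    have "expected_cost I (\<lambda>_. P) = e2ennreal (joint_cost I P)"
      using prob_space.emeasure_space_1[OF prob] by (simp add: expected_cost_def)
    also have "\<dots> \<le> e2ennreal (ereal (21/20 * ?S))"
      unfolding P_def using pos by (intro e2ennreal_mono joint_cost_commodity_policy_le) auto
    also have "\<dots> = ennreal (21/20 * ?S)" by (simp add: e2ennreal_ereal)
    also have "\<dots> \<le> ennreal ((1 + 2 * eps I / 5) * ((32 / 31) / (sqrt 2 * ln 2)) * ?S)"
    proof (intro ennreal_leI mult_right_mono S)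
      have "1 * (21/20) \<le> (1 + 2 * eps I / 5) * ((32 / 31) / (sqrt 2 * ln 2))"
        using eps sqrt2_ln2_bounds by (intro mult_mono) (auto simp: field_simps)
      then show "21/20 \<le> (1 + 2 * eps I / 5) * ((32 / 31) / (sqrt 2 * ln 2))" by simp
    qed
    finally show ?thesis .
  qed
  ultimately show "\<exists>\<P>. random_policy I \<P> \<and> constructs_within policy_prog 300 2 I \<P> \<and>
      (AE \<omega> in seeds. V_max I (\<P> \<omega>) \<le>
         ereal ((1 + 6 * eps I) * ((7 / 4) / (sqrt 2 * ln 2)) * real (num I) * level_cap I)) \<and>
      expected_cost I \<P> \<le>
         ennreal ((1 + 2 * eps I / 5) * ((32 / 31) / (sqrt 2 * ln 2)) *
           (\<Sum>i<num I. K\<^sub>c I i / That I i + H\<^sub>c I i * That I i))"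
    by (intro exI[of _ "\<lambda>_. P"]) simp
qed

end
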